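(* Let $\mathcal{H}$ be a separable Hilbert space and let $\Phi:=(\varphi_1,\ldots,\varphi_k)$ be a commuting $k$-tuple of $w^*$-continuous positive linear maps on $B(\mathcal{H})$. Then the following statements are equivalent. (i) $\Phi$ is jointly similar to a commuting $k$-tuple $\Lambda:=(\lambda_1,\ldots,\lambda_k)$ of $w^*$-continuous positive linear maps on $B(\mathcal{H})$ with $\lambda_i(I)=I$ for $i\in\{1,\ldots,k\}$. (ii) There exist constants $0<c\leq d$ such that $$cI\leq\varphi_1^{s_1}\circ\cdots\circ\varphi_k^{s_k}(I)\leq dI,\qquad(s_1,\ldots,s_k)\in\mathbb{Z}_+^k.$$ (iii) There exist constants $0<c\leq d$ such that $$cI\leq\frac{1}{p^{(1)}\cdots p^{(k)}}\sum_{s_k=0}^{p^{(k)}-1}\cdots\sum_{s_1=0}^{p^{(1)}-1}\varphi_k^{s_k}\circ\cdots\circ\varphi_1^{s_1}(I)\leq dI$$ for any $p^{(1)},\ldots,p^{(k)}\in\mathbb{N}$. (iv) There is a positive invertible operator $Q\in B(\mathcal{H})$ such that $\varphi_i(Q)=Q$ for any $i\in\{1,\ldots,k\}$.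
   Context: $\mathbb{N}=\{1,2,\ldots\}$, $\mathbb{Z}_+=\{0,1,\ldots\}$; powers of linear maps are iterates under composition. A $k$-tuple of linear maps on $B(\mathcal{H})$ is commuting if its entries pairwise commute under composition. $\Phi$ is jointly similar to $\Lambda$ if there is an invertible operator $R\in B(\mathcal{H})$ such that $\varphi_i(RXR^* )=R\lambda_i(X)R^*$ for all $X\in B(\mathcal{H})$ and $i\in\{1,\ldots,k\}$. *)

theory Defs
  imports "HOL-Analysis.Analysis"
begin

section \<open>Complex Hilbert spaces\<close>

class complex_vector = real_vector +
  fixes scaleC :: "complex \<Rightarrow> 'a \<Rightarrow> 'a" (infixr \<open>*\<^sub>C\<close> 75)
  assumes scaleC_add_right: "a *\<^sub>C (x + y) = a *\<^sub>C x + a *\<^sub>C y"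
    and scaleC_add_left: "(a + b) *\<^sub>C x = a *\<^sub>C x + b *\<^sub>C x"
    and scaleC_scaleC: "a *\<^sub>C b *\<^sub>C x = (a * b) *\<^sub>C x"
    and scaleC_of_real: "complex_of_real r *\<^sub>C x = r *\<^sub>R x"

text \<open>The complex inner product is linear in the first argument. Its positive definiteness and
  the identity of \<open>cinner x x\<close> with the squared norm come from \<open>inner_eq_Re_cinner\<close>
  and the axioms of \<^class>\<open>real_inner\<close>.\<close>

class complex_hilbert_space = complex_vector + real_inner + banach +
  fixes cinner :: "'a \<Rightarrow> 'a \<Rightarrow> complex"
  assumes cinner_add_left: "cinner (x + y) z = cinner x z + cinner y z"
    and cinner_scaleC_left: "cinner (a *\<^sub>C x) y = a * cinner x y"
    and cinner_commute: "cinner x y = cnj (cinner y x)"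
    and inner_eq_Re_cinner: "inner x y = Re (cinner x y)"

lemma vector_space_scaleC: "vector_space (scaleC :: complex \<Rightarrow> 'a \<Rightarrow> 'a::complex_vector)"
proof
  show "1 *\<^sub>C x = x" for x :: 'a
    using scaleC_of_real[of 1 x] by simp
qed (simp_all add: scaleC_add_right scaleC_add_left scaleC_scaleC)

lemma scaleC_zero_right [simp]: "a *\<^sub>C (0::'a::complex_vector) = 0"
  using scaleC_add_right[of a "0::'a" 0] by simp

lemma scaleC_minus_right: "a *\<^sub>C (- x) = - (a *\<^sub>C (x::'a::complex_vector))"
  using scaleC_add_right[of a x "- x"] by (simp add: minus_unique)

lemma scaleC_diff_right: "a *\<^sub>C (x - y) = a *\<^sub>C x - a *\<^sub>C (y::'a::complex_vector)"
  using scaleC_add_right[of a x "- y"] by (simp add: scaleC_minus_right)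

lemma scaleC_scaleR: "a *\<^sub>C (r *\<^sub>R x) = r *\<^sub>R (a *\<^sub>C (x::'a::complex_vector))"
  by (metis scaleC_of_real scaleC_scaleC mult.commute)

lemma cinner_add_right:
  "cinner x (y + z) = cinner x y + cinner x (z::'a::complex_hilbert_space)"
  by (metis cinner_add_left cinner_commute complex_cnj_add)

lemma cinner_scaleC_right:
  "cinner x (a *\<^sub>C y) = cnj a * cinner x (y::'a::complex_hilbert_space)"
  by (metis cinner_commute cinner_scaleC_left complex_cnj_mult)

lemma cinner_zero_left [simp]: "cinner 0 (y::'a::complex_hilbert_space) = 0"
  using cinner_add_left[of 0 0 y] by simp

lemma cinner_zero_right [simp]: "cinner (x::'a::complex_hilbert_space) 0 = 0"
  using cinner_add_right[of x 0 0] by simp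

lemma cinner_minus_left: "cinner (- x) y = - cinner x (y::'a::complex_hilbert_space)"
  using cinner_add_left[of x "- x" y] by (simp add: minus_unique)

lemma cinner_self: "cinner x x = complex_of_real ((norm (x::'a::complex_hilbert_space))\<^sup>2)"
proof (rule complex_eqI)
  show "Im (cinner x x) = Im (complex_of_real ((norm x)\<^sup>2))"
    using arg_cong[OF cinner_commute[of x x], of Im] by simp
qed (simp add: power2_norm_eq_inner inner_eq_Re_cinner)

lemma norm_scaleC: "norm (a *\<^sub>C x) = cmod a * norm (x::'a::complex_hilbert_space)"
proof -
  have "complex_of_real ((norm (a *\<^sub>C x))\<^sup>2) = (a * cnj a) * cinner x x"
    unfolding cinner_self[symmetric] by (simp add: cinner_scaleC_left cinner_scaleC_right)
  also have "\<dots> = complex_of_real ((cmod a * norm x)\<^sup>2)"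
    by (simp add: cinner_self complex_norm_square power_mult_distrib flip: of_real_power)
  finally have "(norm (a *\<^sub>C x))\<^sup>2 = (cmod a * norm x)\<^sup>2"
    using of_real_eq_iff by blast
  then show ?thesis
    by (simp add: power2_eq_iff_nonneg)
qed

lemma bounded_linear_scaleC: "bounded_linear (\<lambda>x::'a::complex_hilbert_space. a *\<^sub>C x)"
  by (rule bounded_linear_intro[where K = "cmod a"])
    (simp_all add: scaleC_add_right scaleC_scaleR norm_scaleC)


section \<open>The algebra of bounded operators\<close>

text \<open>\<open>'h bop\<close> is $B(H)$ for the Hilbert space \<open>'h\<close>: the type
  \<open>'h \<Rightarrow>\<^sub>L 'h\<close> only asks for real linearity.\<close>

typedef (overloaded) 'h bop =
  "{T :: 'h::complex_hilbert_space \<Rightarrow>\<^sub>L 'h. \<forall>c x. blinfun_apply T (c *\<^sub>C x) = c *\<^sub>C blinfun_apply T x}"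
  by (rule exI[of _ 0]) simp

setup_lifting type_definition_bop

lift_definition bop_apply :: "'h::complex_hilbert_space bop \<Rightarrow> 'h \<Rightarrow> 'h" (infixl \<open>\<cdot>\<close> 100)
  is blinfun_apply .

lemma bop_eqI: "(\<And>x. A \<cdot> x = B \<cdot> x) \<Longrightarrow> A = B"
  by transfer (rule blinfun_eqI)

lemma bop_apply_add [simp]: "A \<cdot> (x + y) = A \<cdot> x + A \<cdot> y"
  by transfer (rule blinfun.add_right)

lemma bop_apply_scaleC [simp]: "A \<cdot> (c *\<^sub>C x) = c *\<^sub>C (A \<cdot> x)"
  by transfer simp

instantiation bop :: (complex_hilbert_space) "{complex_vector, ring, monoid_mult}"
begin

lift_definition zero_bop :: "'a bop" is 0 by simp
lift_definition plus_bop :: "'a bop \<Rightarrow> 'a bop \<Rightarrow> 'a bop" is "(+)"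
  by (simp add: blinfun.add_left scaleC_add_right)
lift_definition uminus_bop :: "'a bop \<Rightarrow> 'a bop" is uminus
  by (simp add: blinfun.minus_left scaleC_minus_right)
lift_definition minus_bop :: "'a bop \<Rightarrow> 'a bop \<Rightarrow> 'a bop" is "(-)"
  by (simp add: blinfun.diff_left scaleC_diff_right)
lift_definition scaleR_bop :: "real \<Rightarrow> 'a bop \<Rightarrow> 'a bop" is "(*\<^sub>R)"
  by (simp add: blinfun.scaleR_left scaleC_scaleR)
lift_definition scaleC_bop :: "complex \<Rightarrow> 'a bop \<Rightarrow> 'a bop"
  is "\<lambda>c T. Blinfun (\<lambda>x. c *\<^sub>C x) o\<^sub>L T"
  by (simp add: bounded_linear_Blinfun_apply bounded_linear_scaleC scaleC_scaleC mult.commute)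
lift_definition one_bop :: "'a bop" is id_blinfun by simp
lift_definition times_bop :: "'a bop \<Rightarrow> 'a bop \<Rightarrow> 'a bop" is "(o\<^sub>L)" by simp

instance
proof
  fix A B C :: "'a bop" and r s :: real and a b :: complex
  show "a *\<^sub>C (A + B) = a *\<^sub>C A + a *\<^sub>C B"
    by transfer (rule blinfun_eqI, simp add: bounded_linear_Blinfun_apply bounded_linear_scaleC
        blinfun.add_left scaleC_add_right)
  show "(a + b) *\<^sub>C A = a *\<^sub>C A + b *\<^sub>C A"
    by transfer (rule blinfun_eqI, simp add: bounded_linear_Blinfun_apply bounded_linear_scaleC
        blinfun.add_left scaleC_add_left)
  show "a *\<^sub>C b *\<^sub>C A = (a * b) *\<^sub>C A"
    by transfer (rule blinfun_eqI, simp add: bounded_linear_Blinfun_apply bounded_linear_scaleC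
        scaleC_scaleC)
  show "complex_of_real r *\<^sub>C A = r *\<^sub>R A"
    by transfer (rule blinfun_eqI, simp add: bounded_linear_Blinfun_apply bounded_linear_scaleC
        blinfun.scaleR_left scaleC_of_real)
qed (transfer; (rule blinfun_eqI)?;
     simp add: algebra_simps blinfun.bilinear_simps)+

end

lemma bop_apply_simps [simp]:
  "0 \<cdot> x = 0" "1 \<cdot> x = x" "(A + B) \<cdot> x = A \<cdot> x + B \<cdot> x" "(A - B) \<cdot> x = A \<cdot> x - B \<cdot> x"
  "(- A) \<cdot> x = - (A \<cdot> x)" "(r *\<^sub>R A) \<cdot> x = r *\<^sub>R (A \<cdot> x)" "(c *\<^sub>C A) \<cdot> x = c *\<^sub>C (A \<cdot> x)"
  "(A * B) \<cdot> x = A \<cdot> (B \<cdot> x)"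
  by (transfer; simp add: blinfun.bilinear_simps bounded_linear_Blinfun_apply
      bounded_linear_scaleC)+

definition bop_invertible :: "'h::complex_hilbert_space bop \<Rightarrow> bool" where
  "bop_invertible A \<longleftrightarrow> (\<exists>B. A * B = 1 \<and> B * A = 1)"

definition bop_adjoint :: "'h::complex_hilbert_space bop \<Rightarrow> 'h bop" where
  "bop_adjoint A = (THE B. \<forall>x y. cinner (A \<cdot> x) y = cinner x (B \<cdot> y))"

definition bop_positive :: "'h::complex_hilbert_space bop \<Rightarrow> bool" where
  "bop_positive A \<longleftrightarrow> (\<forall>x. cinner (A \<cdot> x) x \<in> \<real> \<and> 0 \<le> Re (cinner (A \<cdot> x) x))"

lemma bop_eq_0I:
  fixes A :: "'h::complex_hilbert_space bop"
  assumes "\<And>x. cinner (A \<cdot> x) x = 0"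
  shows "A = 0"
proof (rule bop_eqI)
  fix x
  have *: "cinner (A \<cdot> x) y + cinner (A \<cdot> y) x = 0" for x y
    using assms[of "x + y"] assms[of x] assms[of y]
    by (simp add: cinner_add_left cinner_add_right add.commute)
  have "cinner (A \<cdot> x) y = 0" for y
  proof -
    have "\<i> * (cinner (A \<cdot> y) x - cinner (A \<cdot> x) y) = 0"
      using *[of x "\<i> *\<^sub>C y"]
      by (simp add: cinner_scaleC_left cinner_scaleC_right algebra_simps)
    then show ?thesis
      using *[of x y] by simp
  qed
  from this[of "A \<cdot> x"] show "A \<cdot> x = 0 \<cdot> x"
    by (simp add: cinner_self)
qed

instantiation bop :: (complex_hilbert_space) order
begin

definition less_eq_bop :: "'a bop \<Rightarrow> 'a bop \<Rightarrow> bool" where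
  "A \<le> B \<longleftrightarrow> bop_positive (B - A)"

definition less_bop :: "'a bop \<Rightarrow> 'a bop \<Rightarrow> bool" where
  "(A :: 'a bop) < B \<longleftrightarrow> A \<le> B \<and> \<not> B \<le> A"

instance
proof
  fix A B C :: "'a bop"
  show "A < B \<longleftrightarrow> A \<le> B \<and> \<not> B \<le> A"
    by (rule less_bop_def)
  show "A \<le> A"
    by (simp add: less_eq_bop_def bop_positive_def)
  show "A \<le> C" if "A \<le> B" "B \<le> C"
  proof -
    have "cinner ((C - A) \<cdot> x) x = cinner ((C - B) \<cdot> x) x + cinner ((B - A) \<cdot> x) x" for x
      by (simp flip: cinner_add_left)
    with that show ?thesis
      by (auto simp add: less_eq_bop_def bop_positive_def simp del: bop_apply_simps)
  qed
  show "A = B" if "A \<le> B" "B \<le> A"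
  proof -
    have "cinner ((B - A) \<cdot> x) x = 0" for x
    proof -
      have "cinner ((A - B) \<cdot> x) x = - cinner ((B - A) \<cdot> x) x"
        by (simp flip: cinner_minus_left)
      with that show ?thesis
        unfolding less_eq_bop_def bop_positive_def
        by (auto simp add: complex_eq_iff complex_is_Real_iff simp del: bop_apply_simps
            dest!: spec[of _ x])
    qed
    then show ?thesis
      using bop_eq_0I[of "B - A"] by simp
  qed
qed

end

instance bop :: (complex_hilbert_space) ordered_ab_group_add
  by standard (simp add: less_eq_bop_def)


section \<open>The weak-star topology and maps on the algebra of bounded operators\<close>

text \<open>The predual of $B(H)$ is the space of trace class operators. Under the trace duality it
  consists of the functionals $X \mapsto \sum_n \langle X \xi_n, \eta_n\rangle$ with
  square-summable sequences of norms $\|\xi_n\|$ and $\|\eta_n\|$.\<close>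

definition normal_functional ::
    "(nat \<Rightarrow> 'h) \<Rightarrow> (nat \<Rightarrow> 'h) \<Rightarrow> 'h::complex_hilbert_space bop \<Rightarrow> complex" where
  "normal_functional \<xi> \<eta> X = (\<Sum>n. cinner (X \<cdot> \<xi> n) (\<eta> n))"

definition weak_star :: "'h::complex_hilbert_space bop topology" where
  "weak_star = topology_generated_by
     {normal_functional \<xi> \<eta> -` U | \<xi> \<eta> U.
        summable (\<lambda>n. (norm (\<xi> n))\<^sup>2) \<and> summable (\<lambda>n. (norm (\<eta> n))\<^sup>2) \<and> open U}"

definition positive_linear_map ::
    "('h::complex_hilbert_space bop \<Rightarrow> 'h bop) \<Rightarrow> bool" where
  "positive_linear_map \<phi> \<longleftrightarrow>
     Vector_Spaces.linear scaleC scaleC \<phi> \<and> (\<forall>X. 0 \<le> X \<longrightarrow> 0 \<le> \<phi> X)"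

text \<open>A \<open>k\<close>-tuple of maps is a function on \<^typ>\<open>nat\<close> of which only the values at
  \<open>1, \<dots>, k\<close> matter.\<close>

definition commuting_positive_tuple ::
    "nat \<Rightarrow> (nat \<Rightarrow> 'h::complex_hilbert_space bop \<Rightarrow> 'h bop) \<Rightarrow> bool" where
  "commuting_positive_tuple k \<Phi> \<longleftrightarrow>
     (\<forall>i\<in>{1..k}. positive_linear_map (\<Phi> i) \<and> continuous_map weak_star weak_star (\<Phi> i)) \<and>
     (\<forall>i\<in>{1..k}. \<forall>j\<in>{1..k}. \<Phi> i \<circ> \<Phi> j = \<Phi> j \<circ> \<Phi> i)"

definition jointly_similar ::
    "nat \<Rightarrow> (nat \<Rightarrow> 'h::complex_hilbert_space bop \<Rightarrow> 'h bop) \<Rightarrow>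
      (nat \<Rightarrow> 'h bop \<Rightarrow> 'h bop) \<Rightarrow> bool" where
  "jointly_similar k \<Phi> \<Lambda> \<longleftrightarrow>
     (\<exists>R. bop_invertible R \<and>
        (\<forall>X. \<forall>i\<in>{1..k}. \<Phi> i (R * X * bop_adjoint R) = R * \<Lambda> i X * bop_adjoint R))"

text \<open>For a list \<open>[i\<^sub>1, \<dots>, i\<^sub>m]\<close> of indices this is
  $\varphi_{i_1}^{s_{i_1}} \circ \cdots \circ \varphi_{i_m}^{s_{i_m}}$.\<close>

definition comp_powers ::
    "(nat \<Rightarrow> 'a \<Rightarrow> 'a) \<Rightarrow> (nat \<Rightarrow> nat) \<Rightarrow> nat list \<Rightarrow> 'a \<Rightarrow> 'a" where
  "comp_powers \<Phi> s js = foldr (\<circ>) (map (\<lambda>i. \<Phi> i ^^ s i) js) id"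

definition all_equivalent :: "bool list \<Rightarrow> bool" where
  "all_equivalent Ps \<longleftrightarrow> (\<forall>P\<in>set Ps. \<forall>Q\<in>set Ps. P \<longleftrightarrow> Q)"

end

theory Submission
  imports Defs
begin

text \<open>The heart of the proof is that mean boundedness yields a fixed point. The lower bound for the
  means over the box of sides \<open>s\<^sub>i + 1\<close> and the upper bound over the box of twice that size give
  $\varphi^s(I) \leq 2^k c^{-1} d I$. Hence the means \<open>M\<^sub>n\<close> over the cubes of side \<open>n\<close> satisfy
  $\|\varphi_i(M_n) - M_n\| = O(1/n)$, since only two faces of the cube survive, and by
  weak-star continuity every weak-star cluster point \<open>Q \<ge> cI\<close> of the \<open>M\<^sub>n\<close> is fixed by all
  $\varphi_i$. Conversely, a positive invertible fixed point lies between multiples of \<open>I\<close>, which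
  bounds all $\varphi^s(I)$, and conjugation by a self-adjoint \<open>R\<close> with \<open>R\<^sup>2 = Q\<close> turns the tuple
  into a unital one.\<close>

section \<open>Bounded operators as a Banach algebra\<close>

text \<open>The obstacle is the far face of the cube. After cancellation,
  \<open>\<Phi> i M - M\<close> is a difference of two face sums divided by the volume of the cube.
  A bound on means only shows that the far layer is comparable to the whole cube, so nothing would
  decay. This is why the powers are bounded one by one beforehand. Positivity makes that possible:
  it preserves the comparison of the identity with a box mean, and it allows all terms outside the
  translated box to be added for free. The factor 2^k is the ratio of the volumes of the two boxes.
  Estimates are order inequalities against multiples of the identity, turned into norm bounds
  through \<open>positive_norm_le\<close> where convergence is at stake. The lower bound has a
  second task: it survives weak limits, while invertibility by itself does not, and so it keeps
  \<open>Q\<close> invertible.\<close>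

instantiation bop :: (complex_hilbert_space) real_normed_algebra
begin

lift_definition norm_bop :: "'a bop \<Rightarrow> real" is norm .

definition dist_bop :: "'a bop \<Rightarrow> 'a bop \<Rightarrow> real"
  where "dist_bop A B = norm (A - B)"

definition sgn_bop :: "'a bop \<Rightarrow> 'a bop"
  where "sgn_bop A = A /\<^sub>R norm A"

definition [code del]:
  "(uniformity :: ('a bop \<times> 'a bop) filter) = (INF e\<in>{0 <..}. principal {(x, y). dist x y < e})"

definition open_bop :: "'a bop set \<Rightarrow> bool"
  where [code del]: "open_bop S = (\<forall>x\<in>S. \<forall>\<^sub>F (x', y) in uniformity. x' = x \<longrightarrow> y \<in> S)"

instance
proof
  fix A B :: "'a bop" and r :: real
  show "(r *\<^sub>R A) * B = r *\<^sub>R (A * B)" "A * (r *\<^sub>R B) = r *\<^sub>R (A * B)"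
    by (transfer; rule blinfun_eqI; simp add: blinfun.bilinear_simps)+
  show "(norm A = 0) = (A = 0)" "norm (A + B) \<le> norm A + norm B"
    "norm (r *\<^sub>R A) = \<bar>r\<bar> * norm A" "norm (A * B) \<le> norm A * norm B"
    by (transfer; simp add: norm_triangle_ineq norm_blinfun_compose)+
qed (fact dist_bop_def sgn_bop_def uniformity_bop_def open_bop_def)+

end

lemma norm_bop_apply: "norm (A \<cdot> x) \<le> norm A * norm x"
  by transfer (rule norm_blinfun)

lemma norm_bop_le:
  assumes "0 \<le> K" and "\<And>x. norm (A \<cdot> x) \<le> K * norm x"
  shows "norm A \<le> K"
  using assms by transfer (rule norm_blinfun_bound)

lemma bounded_bilinear_bop_apply: "bounded_bilinear (\<cdot>)"
proof
  show "\<exists>K. \<forall>A (x :: 'a). norm (A \<cdot> x) \<le> norm A * norm x * K"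
    by (rule exI[of _ 1]) (simp add: norm_bop_apply)
  show "A \<cdot> (r *\<^sub>R x) = r *\<^sub>R (A \<cdot> x)" for A r and x :: 'a
    using bop_apply_scaleC[of A "complex_of_real r" x] by (simp add: scaleC_of_real)
qed simp_all

interpretation bop_apply: bounded_bilinear "(\<cdot>)"
  by (rule bounded_bilinear_bop_apply)

instance bop :: (complex_hilbert_space) banach
proof
  fix X :: "nat \<Rightarrow> 'a bop"
  assume "Cauchy X"
  moreover have "dist (X m) (X n) = dist (Rep_bop (X m)) (Rep_bop (X n))" for m n
    by (simp add: dist_norm norm_bop.rep_eq minus_bop.rep_eq)
  ultimately have "Cauchy (\<lambda>n. Rep_bop (X n))"
    by (simp add: Cauchy_def)
  then obtain L where L: "(\<lambda>n. Rep_bop (X n)) \<longlonglongrightarrow> L"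
    by (auto simp: Cauchy_convergent_iff convergent_def)
  have apply_L: "(\<lambda>n. blinfun_apply (Rep_bop (X n)) x) \<longlonglongrightarrow> blinfun_apply L x" for x
    by (intro blinfun.tendsto L tendsto_const)
  \<comment> \<open>The limit is taken among real-linear maps; complex homogeneity has to pass to
    the limit before \<open>Abs_bop\<close> makes sense on \<open>L\<close>.\<close>
  have "blinfun_apply L (c *\<^sub>C x) = c *\<^sub>C blinfun_apply L x" for c x
  proof (rule LIMSEQ_unique[OF apply_L])
    have "(\<lambda>n. c *\<^sub>C blinfun_apply (Rep_bop (X n)) x) \<longlonglongrightarrow> c *\<^sub>C blinfun_apply L x"
      by (intro bounded_linear.tendsto[OF bounded_linear_scaleC] apply_L)
    then show "(\<lambda>n. blinfun_apply (Rep_bop (X n)) (c *\<^sub>C x)) \<longlonglongrightarrow> c *\<^sub>C blinfun_apply L x"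
      using Rep_bop[of "X _"] by simp
  qed
  then have "Rep_bop (Abs_bop L) = L"
    by (simp add: Abs_bop_inverse)
  then have "norm (X n - Abs_bop L) = norm (Rep_bop (X n) - L)" for n
    by (simp add: norm_bop.rep_eq minus_bop.rep_eq)
  then have "X \<longlonglongrightarrow> Abs_bop L"
    using L by (simp add: lim_sequentially dist_norm)
  then show "convergent X"
    by (auto simp: convergent_def)
qed

text \<open>A right and a left inverse arise as fixed points of the contractions
  \<open>S \<mapsto> 1 + T * S\<close> and \<open>S \<mapsto> 1 + S * T\<close>; associativity
  forces them to agree.\<close>

lemma one_minus_bop_invertible:
  fixes T :: "'h::complex_hilbert_space bop"
  assumes "norm T < 1"
  shows "bop_invertible (1 - T)"
proof -
  have "\<exists>!S. 1 + T * S = S"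
  proof (rule banach_fix_type[OF norm_ge_zero assms], intro allI)
    show "dist (1 + T * X) (1 + T * Y) \<le> norm T * dist X Y" for X Y
      using norm_mult_ineq[of T "X - Y"] by (simp add: dist_norm right_diff_distrib)
  qed
  then obtain S where S: "1 + T * S = S"
    by blast
  have "\<exists>!S. 1 + S * T = S"
  proof (rule banach_fix_type[OF norm_ge_zero assms], intro allI)
    show "dist (1 + X * T) (1 + Y * T) \<le> norm T * dist X Y" for X Y
      using norm_mult_ineq[of "X - Y" T] by (simp add: dist_norm left_diff_distrib mult.commute)
  qed
  then obtain S' where S': "1 + S' * T = S'"
    by blast
  have "(1 - T) * S = 1" "S' * (1 - T) = 1"
    using S S' by (simp_all add: left_diff_distrib right_diff_distrib algebra_simps)
  moreover from this have "S' = S"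
    by (metis mult.assoc mult_1_left mult_1_right)
  ultimately show ?thesis
    unfolding bop_invertible_def by auto
qed


section \<open>The Riesz representation theorem and adjoints\<close>

text \<open>The representing vector is the minimizer of \<open>J\<close>, because for it
  \<open>J x\<close> is the squared distance from \<open>x\<close> to \<open>y\<close> minus the
  constant \<open>(norm y)\<^sup>2\<close>.\<close>

lemma real_riesz_representation:
  fixes f :: "'h::{real_inner, banach} \<Rightarrow> real"
  assumes f: "bounded_linear f"
  obtains y where "\<And>x. f x = inner x y"
proof -
  interpret f: bounded_linear f by (rule f)
  obtain K where K: "\<And>x. norm (f x) \<le> norm x * K"
    using f.bounded by blast
  define J where "J x = (norm x)\<^sup>2 - 2 * f x" for x
  have J_lower: "- (K\<^sup>2) \<le> J x" for x
  proof -
    have "f x \<le> norm x * K"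
      using K[of x] by simp
    moreover have "0 \<le> (norm x - K)\<^sup>2"
      by simp
    ultimately show ?thesis
      unfolding J_def by (simp add: power2_diff)
  qed
  define m where "m = (INF x. J x)"
  have bdd: "bdd_below (range J)"
    by (rule bdd_belowI2[of _ "- (K\<^sup>2)"]) (rule J_lower)
  have m_le: "m \<le> J x" for x
    unfolding m_def by (rule cINF_lower[OF bdd]) simp
  have "\<exists>x. J x < m + inverse (real (Suc n))" for n
    using cInf_lessD[of "range J" "m + inverse (real (Suc n))"] by (auto simp: m_def)
  then obtain u where u: "\<And>n. J (u n) < m + inverse (real (Suc n))"
    by metis
  \<comment> \<open>The parallelogram law makes every minimizing sequence of \<open>J\<close> a Cauchy sequence.\<close>
  have mid: "(norm (x - y))\<^sup>2 = 2 * J x + 2 * J y - 4 * J ((1/2) *\<^sub>R (x + y))" for x y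
    unfolding J_def by (simp add: power2_norm_eq_inner f.scaleR f.add algebra_simps inner_commute)
  have "Cauchy u"
  proof (rule metric_CauchyI)
    fix e :: real assume "0 < e"
    then obtain N where N: "inverse (real (Suc N)) < e\<^sup>2 / 4"
      using reals_Archimedean[of "e\<^sup>2 / 4"] by auto
    have "dist (u i) (u j) < e" if "N \<le> i" "N \<le> j" for i j
    proof -
      have "inverse (real (Suc i)) \<le> inverse (real (Suc N))"
        "inverse (real (Suc j)) \<le> inverse (real (Suc N))"
        using that by (simp_all add: field_simps)
      then have "(norm (u i - u j))\<^sup>2 < e\<^sup>2"
        using mid[of "u i" "u j"] m_le[of "(1/2) *\<^sub>R (u i + u j)"] u[of i] u[of j] N by linarith
      then show ?thesis
        using \<open>0 < e\<close> by (simp add: dist_norm power2_less_imp_less)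
    qed
    then show "\<exists>N. \<forall>i\<ge>N. \<forall>j\<ge>N. dist (u i) (u j) < e"
      by blast
  qed
  then obtain y where y: "u \<longlonglongrightarrow> y"
    by (auto simp: Cauchy_convergent_iff convergent_def)
  have "(\<lambda>n. J (u n)) \<longlonglongrightarrow> J y"
    unfolding J_def by (intro tendsto_intros f.tendsto y)
  moreover have "(\<lambda>n. m + inverse (real (Suc n))) \<longlonglongrightarrow> m + 0"
    by (intro tendsto_intros LIMSEQ_inverse_real_of_nat)
  ultimately have "J y \<le> m + 0"
    by (rule LIMSEQ_le) (use u in \<open>blast intro: less_imp_le\<close>)
  then have "J y \<le> m"
    by simp
  have "f x = inner x y" for x
  proof -
    define a where "a = inner x y - f x"
    \<comment> \<open>First variation at the minimizer: \<open>J (y + t *\<^sub>R x) - J y\<close>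
      is this quadratic in \<open>t\<close>.\<close>
    have *: "0 \<le> 2 * t * a + t\<^sup>2 * (norm x)\<^sup>2" for t
    proof -
      have "(norm (y + t *\<^sub>R x))\<^sup>2 = (norm y)\<^sup>2 + 2 * t * inner x y + t\<^sup>2 * (norm x)\<^sup>2"
        unfolding power2_norm_eq_inner
        by (simp add: inner_add_left inner_add_right inner_commute power2_eq_square)
      then show ?thesis
        using order_trans[OF \<open>J y \<le> m\<close> m_le[of "y + t *\<^sub>R x"]]
        by (simp add: J_def a_def f.scaleR f.add algebra_simps)
    qed
    \<comment> \<open>The quadratic is smallest at \<open>- a / (norm x)\<^sup>2\<close>; adding 1
      avoids division by zero and still makes its value negative unless
      \<open>a = 0\<close>.\<close>
    define t where "t = - a / ((norm x)\<^sup>2 + 1)"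
    have ta: "t * ((norm x)\<^sup>2 + 1) = - a"
      unfolding t_def
      by (simp add: add_nonneg_eq_0_iff)
    have "2 * t * a + t\<^sup>2 * (norm x)\<^sup>2 = - (t\<^sup>2 * ((norm x)\<^sup>2 + 2))"
    proof -
      have a: "a = - (t * ((norm x)\<^sup>2 + 1))"
        using ta by simp
      show ?thesis
        unfolding a by (simp add: algebra_simps power2_eq_square)
    qed
    with *[of t] have "t\<^sup>2 * ((norm x)\<^sup>2 + 2) \<le> 0"
      by simp
    moreover have "0 < (norm x)\<^sup>2 + 2"
      by (simp add: add_nonneg_pos)
    ultimately have "t\<^sup>2 \<le> 0"
      by (simp add: mult_le_0_iff)
    then show ?thesis
      using ta by (simp add: a_def)
  qed
  then show thesis
    by (rule that)
qed

text \<open>Conjugate linearity in the second argument makes multiplication by \<open>\<i>\<close>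
  there move the imaginary part into the real part. This carries the real Riesz theorem over to
  complex forms.\<close>

lemma cinner_eq_inner: "cinner x y = Complex (inner x y) (inner x (\<i> *\<^sub>C y))"
  for x y :: "'h::complex_hilbert_space"
  by (rule complex_eqI) (simp_all add: inner_eq_Re_cinner cinner_scaleC_right)

lemma norm_cinner_le: "norm (cinner x y) \<le> norm x * norm y"
  for x y :: "'h::complex_hilbert_space"
proof (cases "cinner x y = 0")
  case False
  \<comment> \<open>A unit scalar rotating \<open>cinner x y\<close> onto its modulus, so that the
    real Cauchy-Schwarz inequality applies.\<close>
  define u where "u = cnj (cinner x y) / cmod (cinner x y)"
  have u: "cmod u = 1"
    using False by (simp add: u_def norm_divide)
  have "cinner (u *\<^sub>C x) y = cmod (cinner x y)"
    using False complex_norm_square[of "cinner x y"]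
    by (simp add: cinner_scaleC_left u_def power2_eq_square field_simps)
  then have "cmod (cinner x y) = inner (u *\<^sub>C x) y"
    by (simp add: inner_eq_Re_cinner)
  also have "\<dots> \<le> norm x * norm y"
    using norm_cauchy_schwarz[of "u *\<^sub>C x" y] by (simp add: norm_scaleC u)
  finally show ?thesis .
qed simp

lemma cinner_scaleR_left: "cinner (r *\<^sub>R x) y = r *\<^sub>R cinner x y"
  and cinner_scaleR_right: "cinner x (r *\<^sub>R y) = r *\<^sub>R cinner x y"
  for x y :: "'h::complex_hilbert_space"
  by (simp_all add: cinner_scaleC_left cinner_scaleC_right scaleR_conv_of_real
      flip: scaleC_of_real)

lemma bounded_bilinear_cinner:
  "bounded_bilinear (cinner :: 'h \<Rightarrow> 'h::complex_hilbert_space \<Rightarrow> complex)"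
proof
  show "\<exists>K. \<forall>(x :: 'h) y. norm (cinner x y) \<le> norm x * norm y * K"
    by (rule exI[of _ 1]) (simp add: norm_cinner_le)
qed (simp_all add: cinner_add_left cinner_add_right cinner_scaleR_left cinner_scaleR_right)

interpretation cinner: bounded_bilinear
  "cinner :: 'h \<Rightarrow> 'h::complex_hilbert_space \<Rightarrow> complex"
  by (rule bounded_bilinear_cinner)

lemma cinner_eqI: "x = y" if "\<And>z. cinner x z = cinner y z"
  for x y :: "'h::complex_hilbert_space"
proof -
  have "cinner (x - y) (x - y) = 0"
    using that[of "x - y"] by (simp add: cinner.diff_left)
  then show ?thesis
    by (simp add: cinner_self)
qed

text \<open>For fixed \<open>x\<close>, real Riesz represents the real part of \<open>f x\<close>,
  and evaluating at \<open>\<i> *\<^sub>C y\<close> recovers the imaginary part. Uniqueness of the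
  representing vector makes it linear in \<open>x\<close>. The lemma supplies both adjoints and weak
  cluster points.\<close>

lemma sesquilinear_form_representation:
  fixes f :: "'h::complex_hilbert_space \<Rightarrow> 'h \<Rightarrow> complex"
  assumes add_left: "\<And>x y z. f (x + y) z = f x z + f y z"
    and scale_left: "\<And>c x z. f (c *\<^sub>C x) z = c * f x z"
    and add_right: "\<And>x y z. f x (y + z) = f x y + f x z"
    and scale_right: "\<And>c x z. f x (c *\<^sub>C z) = cnj c * f x z"
    and bound: "\<And>x y. norm (f x y) \<le> K * norm x * norm y"
  shows "\<exists>A. \<forall>x y. cinner (A \<cdot> x) y = f x y"
proof -
  have "\<exists>q. \<forall>y. cinner q y = f x y" for x
  proof -
    have "bounded_linear (\<lambda>y. Re (f x y))"
    proof (rule bounded_linear_intro[where K = "K * norm x"])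
      show "Re (f x (r *\<^sub>R y)) = r *\<^sub>R Re (f x y)" for r y
        using scale_right[of x "complex_of_real r" y] by (simp add: scaleC_of_real)
      show "norm (Re (f x y)) \<le> norm y * (K * norm x)" for y
        using order_trans[OF abs_Re_le_cmod bound[of x y]] by (simp add: algebra_simps)
    qed (simp add: add_right)
    then obtain q where q: "\<And>y. Re (f x y) = inner y q"
      using real_riesz_representation by blast
    have "cinner q y = f x y" for y
      by (rule complex_eqI)
        (use q[of y] q[of "\<i> *\<^sub>C y"] in
          \<open>simp_all add: cinner_eq_inner inner_commute scale_right\<close>)
    then show ?thesis
      by blast
  qed
  then obtain q where q: "\<And>x y. cinner (q x) y = f x y"
    by metis
  have scaleC: "q (c *\<^sub>C x) = c *\<^sub>C q x" for c x
    by (rule cinner_eqI) (simp add: q scale_left cinner_scaleC_left)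
  have "bounded_linear q"
  proof (rule bounded_linear_intro[where K = K])
    show "q (x + y) = q x + q y" for x y
      by (rule cinner_eqI) (simp add: q add_left cinner_add_left)
    show "q (r *\<^sub>R x) = r *\<^sub>R q x" for r x
      using scaleC[of "complex_of_real r" x] by (simp add: scaleC_of_real)
    show "norm (q x) \<le> norm x * K" for x
    proof (cases "q x = 0")
      case True
      \<comment> \<open>The sign of \<open>K\<close> is unknown, so it is read off from the bound on
        the diagonal when \<open>x\<close> is nonzero.\<close>
      have "norm (f x x) \<le> K * norm x * norm x"
        by (rule bound)
      then have "0 \<le> K * norm x * norm x"
        using norm_ge_zero order_trans by blast
      then show ?thesis
        using True by (cases "x = 0") (auto simp: zero_le_mult_iff)
    next
      case False
      have "norm (q x) * norm (q x) = norm (f x (q x))"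
        using q[of x "q x"] by (simp add: cinner_self power2_eq_square norm_mult flip: q)
      also have "\<dots> \<le> K * norm x * norm (q x)"
        by (rule bound)
      finally show ?thesis
        using False by (simp add: mult.commute)
    qed
  qed
  then have "blinfun_apply (Rep_bop (Abs_bop (Blinfun q))) = q"
    by (simp add: Abs_bop_inverse bounded_linear_Blinfun_apply scaleC)
  then show ?thesis
    by (intro exI[of _ "Abs_bop (Blinfun q)"]) (simp add: bop_apply.rep_eq q)
qed

lemma cinner_bop_adjoint: "cinner (A \<cdot> x) y = cinner x (bop_adjoint A \<cdot> y)"
proof -
  have bound: "norm (cinner x (A \<cdot> y)) \<le> norm A * norm x * norm y" for x y
    using order_trans[OF norm_cinner_le mult_left_mono[OF norm_bop_apply norm_ge_zero]]
    by (simp add: algebra_simps)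
  have "\<exists>B. \<forall>x y. cinner (B \<cdot> x) y = cinner x (A \<cdot> y)"
    by (rule sesquilinear_form_representation[where K = "norm A"])
      (simp_all add: cinner_add_left cinner_add_right cinner_scaleC_left cinner_scaleC_right bound)
  then obtain B where B: "\<And>x y. cinner (B \<cdot> x) y = cinner x (A \<cdot> y)"
    by blast
  have adj: "\<forall>x y. cinner (A \<cdot> x) y = cinner x (B \<cdot> y)"
    by (metis B cinner_commute)
  have "\<forall>x y. cinner (A \<cdot> x) y = cinner x (bop_adjoint A \<cdot> y)"
    unfolding bop_adjoint_def
  proof (rule theI)
    fix C assume "\<forall>x y. cinner (A \<cdot> x) y = cinner x (C \<cdot> y)"
    with adj have "cinner (C \<cdot> y) x = cinner (B \<cdot> y) x" for x y
      by (metis cinner_commute)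
    then show "C = B"
      by (intro bop_eqI cinner_eqI)
  qed (rule adj)
  then show ?thesis
    by blast
qed

lemma bop_adjoint_eqI:
  assumes "\<And>x y. cinner (A \<cdot> x) y = cinner x (B \<cdot> y)"
  shows "bop_adjoint A = B"
proof (intro bop_eqI cinner_eqI)
  show "cinner (bop_adjoint A \<cdot> x) z = cinner (B \<cdot> x) z" for x z
    by (metis assms cinner_bop_adjoint cinner_commute)
qed

text \<open>Over the complex scalars a real quadratic form already forces self-adjointness, by the
  polarization argument in \<open>bop_eq_0I\<close>.\<close>

lemma bop_positive_adjoint:
  assumes "0 \<le> A"
  shows "bop_adjoint A = A"
proof -
  have "bop_adjoint A - A = 0"
  proof (rule bop_eq_0I)
    fix x
    have "cinner (A \<cdot> x) x \<in> \<real>"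
      using assms by (simp add: less_eq_bop_def bop_positive_def)
    then have "cinner x (A \<cdot> x) = cinner (A \<cdot> x) x"
      by (metis cinner_commute complex_is_Real_iff complex_cnj_complex_of_real of_real_Re)
    moreover have "cinner (bop_adjoint A \<cdot> x) x = cinner x (A \<cdot> x)"
      by (metis cinner_bop_adjoint cinner_commute)
    ultimately show "cinner ((bop_adjoint A - A) \<cdot> x) x = 0"
      by (simp add: cinner.diff_left)
  qed
  then show ?thesis
    by simp
qed


section \<open>Positive operators\<close>

lemma bop_le_iff:
  assumes "bop_adjoint A = A" "bop_adjoint B = B"
  shows "A \<le> B \<longleftrightarrow> (\<forall>x. inner (A \<cdot> x) x \<le> inner (B \<cdot> x) x)"
proof -
  have "cinner (C \<cdot> x) x \<in> \<real>" if "bop_adjoint C = C" for C and x :: 'a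
    by (metis that cinner_bop_adjoint cinner_commute Reals_cnj_iff)
  with assms show ?thesis
    by (simp add: less_eq_bop_def bop_positive_def inner_eq_Re_cinner cinner.diff_left)
qed

lemma bop_adjoint_scaleR_one [simp]: "bop_adjoint (r *\<^sub>R 1) = r *\<^sub>R 1"
  by (rule bop_adjoint_eqI) (simp add: cinner_scaleR_left cinner_scaleR_right)

lemma bop_le_imp_inner_le:
  assumes "A \<le> B"
  shows "inner (A \<cdot> x) x \<le> inner (B \<cdot> x) x"
  using assms by (simp add: less_eq_bop_def bop_positive_def inner_eq_Re_cinner cinner.diff_left)

lemma bop_scaleR_mono:
  fixes A B :: "'h::complex_hilbert_space bop"
  assumes "A \<le> B" "0 \<le> r"
  shows "r *\<^sub>R A \<le> r *\<^sub>R B"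
proof -
  have "r *\<^sub>R B - r *\<^sub>R A = r *\<^sub>R (B - A)"
    by (simp add: scaleR_diff_right)
  with assms show ?thesis
    unfolding less_eq_bop_def bop_positive_def
    by (simp add: cinner_scaleR_left complex_is_Real_iff del: bop_apply_simps(4))
qed

lemma bop_scaleR_one_mono: "r \<le> s \<Longrightarrow> r *\<^sub>R 1 \<le> s *\<^sub>R (1 :: 'h::complex_hilbert_space bop)"
  by (simp add: bop_le_iff mult_right_mono)

lemma bop_le_norm:
  assumes "bop_adjoint A = A"
  shows "A \<le> norm A *\<^sub>R 1"
proof -
  have "inner (A \<cdot> x) x \<le> norm A * inner x x" for x
  proof -
    have "inner (A \<cdot> x) x \<le> norm (A \<cdot> x) * norm x"
      by (rule norm_cauchy_schwarz)
    also have "\<dots> \<le> norm A * norm x * norm x"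
      by (intro mult_right_mono norm_bop_apply) simp
    finally show ?thesis
      by (simp flip: power2_norm_eq_inner add: power2_eq_square)
  qed
  then show ?thesis
    using assms by (simp add: bop_le_iff)
qed

text \<open>This is the inequality \<open>A * A \<le> D *\<^sub>R A\<close> in terms of forms. It is
  obtained without a square root by testing positivity of \<open>A\<close> on
  \<open>x - (1/D) *\<^sub>R (A \<cdot> x)\<close> and bounding the last term by
  \<open>A \<le> D *\<^sub>R 1\<close>.\<close>

lemma positive_norm_apply_le:
  assumes "0 \<le> A" "A \<le> D *\<^sub>R 1" "0 < D"
  shows "(norm (A \<cdot> x))\<^sup>2 \<le> D * inner (A \<cdot> x) x"
proof -
  let ?y = "A \<cdot> x"
  have sym: "inner (A \<cdot> ?y) x = inner ?y ?y"
    by (metis assms(1) bop_positive_adjoint cinner_bop_adjoint inner_eq_Re_cinner)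
  have "0 \<le> inner (A \<cdot> (x - (1/D) *\<^sub>R ?y)) (x - (1/D) *\<^sub>R ?y)"
    using bop_le_imp_inner_le[OF assms(1)] by simp
  also have "\<dots> = inner ?y x - (2/D) * inner ?y ?y + (1/D)\<^sup>2 * inner (A \<cdot> ?y) ?y"
    by (simp add: bop_apply.diff_right bop_apply.scaleR_right inner_diff_left inner_diff_right
        sym power2_eq_square diff_divide_distrib)
  also have "\<dots> \<le> inner ?y x - (2/D) * inner ?y ?y + (1/D)\<^sup>2 * (D * inner ?y ?y)"
    using bop_le_imp_inner_le[OF assms(2), of ?y] by (intro add_left_mono mult_left_mono) simp_all
  also have "\<dots> = inner ?y x - inner ?y ?y / D"
    using assms(3) by (simp add: power2_eq_square field_simps)
  finally show ?thesis
    using assms(3) by (simp add: power2_norm_eq_inner field_simps)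
qed

lemma positive_norm_le:
  fixes A :: "'h::complex_hilbert_space bop"
  assumes "0 \<le> A" "A \<le> D *\<^sub>R 1" "0 < D"
  shows "norm A \<le> D"
proof (rule norm_bop_le)
  fix x
  have "(norm (A \<cdot> x))\<^sup>2 \<le> D * inner (A \<cdot> x) x"
    by (rule positive_norm_apply_le[OF assms])
  also have "\<dots> \<le> D * (D * inner x x)"
    using assms bop_le_imp_inner_le[OF assms(2), of x] by (intro mult_left_mono) simp_all
  also have "\<dots> = (D * norm x)\<^sup>2"
    by (simp add: power2_norm_eq_inner[symmetric] power2_eq_square)
  finally show "norm (A \<cdot> x) \<le> D * norm x"
    by (rule power2_le_imp_le) (use assms(3) in simp)
qed (use assms(3) in simp)

text \<open>The operator lies between 0 and \<open>(1 - c/d) *\<^sub>R 1\<close>; strictness of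
  \<open>c < d\<close> makes this bound positive, as \<open>positive_norm_le\<close> demands. It
  serves both the inversion of \<open>Q\<close> and the iteration for its square root.\<close>

lemma norm_one_minus_scaled_lt_1:
  fixes Q :: "'h::complex_hilbert_space bop"
  assumes "c *\<^sub>R 1 \<le> Q" "Q \<le> d *\<^sub>R 1" "0 < c" "c < d"
  shows "norm (1 - (1/d) *\<^sub>R Q) < 1" and "0 \<le> 1 - (1/d) *\<^sub>R Q"
proof -
  have d: "0 < d"
    using assms by simp
  have Q1: "(1/d) *\<^sub>R Q \<le> 1"
    using bop_scaleR_mono[OF assms(2), of "1/d"] d by simp
  then show ge: "0 \<le> 1 - (1/d) *\<^sub>R Q"
    by simp
  have "(c/d) *\<^sub>R 1 \<le> (1/d) *\<^sub>R Q"
    using bop_scaleR_mono[OF assms(1), of "1/d"] d by simp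
  then have "1 - (1/d) *\<^sub>R Q \<le> 1 - (c/d) *\<^sub>R 1"
    by (rule diff_left_mono)
  also have "\<dots> = (1 - c/d) *\<^sub>R 1"
    by (simp add: scaleR_diff_left)
  finally have "norm (1 - (1/d) *\<^sub>R Q) \<le> 1 - c/d"
    using ge assms d by (intro positive_norm_le) simp_all
  also have "\<dots> < 1"
    using assms by simp
  finally show "norm (1 - (1/d) *\<^sub>R Q) < 1" .
qed

lemma scaleR_bop_invertible:
  fixes A :: "'h::complex_hilbert_space bop"
  assumes "bop_invertible A" "r \<noteq> 0"
  shows "bop_invertible (r *\<^sub>R A)"
proof -
  obtain B where "A * B = 1" "B * A = 1"
    using assms(1) by (auto simp: bop_invertible_def)
  then have "(r *\<^sub>R A) * ((1/r) *\<^sub>R B) = 1 \<and> ((1/r) *\<^sub>R B) * (r *\<^sub>R A) = 1"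
    using assms(2) by simp
  then show ?thesis
    unfolding bop_invertible_def by blast
qed

lemma bounded_below_bop_invertible:
  fixes Q :: "'h::complex_hilbert_space bop"
  assumes "c *\<^sub>R 1 \<le> Q" "0 < c"
  shows "bop_invertible Q"
proof -
  define d where "d = norm Q + 2 * c"
  have d: "0 < d" "c < d"
    using assms(2) by (simp_all add: d_def add_nonneg_pos add_strict_increasing2)
  have "0 \<le> Q"
    using order_trans[OF bop_scaleR_one_mono[of 0 c] assms(1)] assms(2) by simp
  then have "Q \<le> d *\<^sub>R 1"
    by (intro order_trans[OF bop_le_norm bop_scaleR_one_mono] bop_positive_adjoint)
      (use assms(2) in \<open>simp_all add: d_def\<close>)
  then have "bop_invertible (1 - (1 - (1/d) *\<^sub>R Q))"
    using norm_one_minus_scaled_lt_1(1) assms d by (intro one_minus_bop_invertible) blast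
  then have "bop_invertible ((1/d) *\<^sub>R Q)"
    by simp
  then have "bop_invertible (d *\<^sub>R ((1/d) *\<^sub>R Q))"
    by (rule scaleR_bop_invertible) (use d in simp)
  then show ?thesis
    using d by simp
qed

lemma positive_invertible_bounds:
  fixes Q :: "'h::complex_hilbert_space bop"
  assumes "0 \<le> Q" "bop_invertible Q"
  obtains c d where "0 < c" "c < d" "c *\<^sub>R 1 \<le> Q" "Q \<le> d *\<^sub>R 1"
proof -
  obtain B where B: "B * Q = 1"
    using assms(2) by (auto simp: bop_invertible_def)
  have adj: "bop_adjoint Q = Q"
    using assms(1) by (rule bop_positive_adjoint)
  define D where "D = norm Q + 1"
  have D: "0 < D"
    by (simp add: D_def add_nonneg_pos)
  have le_D: "Q \<le> D *\<^sub>R 1"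
    by (rule order_trans[OF bop_le_norm[OF adj] bop_scaleR_one_mono]) (simp add: D_def)
  define b where "b = norm B + 1"
  have b: "0 < b"
    by (simp add: b_def add_nonneg_pos)
  \<comment> \<open>The constant comes from chaining
    \<open>norm x \<le> b * norm (Q \<cdot> x)\<close> with \<open>positive_norm_apply_le\<close>.
    The added 1 in \<open>D\<close> and \<open>b\<close> keeps them positive even on the trivial
    space.\<close>
  define c where "c = 1 / (D * b\<^sup>2)"
  have "c * inner x x \<le> inner (Q \<cdot> x) x" for x
  proof -
    have "x = B \<cdot> (Q \<cdot> x)"
      using B by (metis bop_apply_simps(2,8))
    then have "norm x \<le> norm B * norm (Q \<cdot> x)"
      by (metis norm_bop_apply)
    also have "\<dots> \<le> b * norm (Q \<cdot> x)"
      by (intro mult_right_mono) (simp_all add: b_def)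
    finally have "(norm x)\<^sup>2 \<le> b\<^sup>2 * (norm (Q \<cdot> x))\<^sup>2"
      by (metis norm_ge_zero power_mono power_mult_distrib)
    also have "\<dots> \<le> b\<^sup>2 * (D * inner (Q \<cdot> x) x)"
      by (intro mult_left_mono positive_norm_apply_le assms(1) le_D D) simp
    finally show ?thesis
      using D b by (simp add: c_def power2_norm_eq_inner field_simps)
  qed
  then have "c *\<^sub>R 1 \<le> Q"
    by (simp add: bop_le_iff adj)
  \<comment> \<open>The upper constant is enlarged by \<open>c\<close> to get the strict inequality
    \<open>c < d\<close>.\<close>
  moreover have "Q \<le> (c + D) *\<^sub>R 1"
    by (rule order_trans[OF le_D bop_scaleR_one_mono]) (use D b in \<open>simp add: c_def\<close>)
  ultimately show thesis
    using D b by (intro that[of c "c + D"]) (simp_all add: c_def)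
qed

text \<open>Self-adjointness is a family of equations between functions continuous in
  \<open>A\<close>. Closedness lets the fixed point iteration for the square root stay among
  self-adjoint operators.\<close>

lemma closed_self_adjoint: "closed {A :: 'h::complex_hilbert_space bop. bop_adjoint A = A}"
proof -
  have "{A :: 'h bop. bop_adjoint A = A} = (\<Inter>x. \<Inter>y. {A. cinner (A \<cdot> x) y = cinner x (A \<cdot> y)})"
    by (auto intro: bop_adjoint_eqI) (metis cinner_bop_adjoint)
  also have "closed \<dots>"
    by (intro closed_INT ballI closed_Collect_eq continuous_intros
        cinner.continuous_on bop_apply.continuous_on)
  finally show ?thesis .
qed

text \<open>Writing \<open>Q / d = 1 - T\<close> and \<open>R = 1 - S\<close>, the equation \<open>R\<^sup>2 = Q / d\<close> reads
  \<open>S = (T + S\<^sup>2) / 2\<close>, whose right-hand side is a contraction of the ball of radius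
  \<open>norm T < 1\<close>.\<close>

lemma self_adjoint_square_root:
  fixes Q :: "'h::complex_hilbert_space bop"
  assumes "0 \<le> Q" "bop_invertible Q"
  obtains R where "R * R = Q" "bop_adjoint R = R" "bop_invertible R"
proof -
  obtain c d where cd: "0 < c" "c < d" "c *\<^sub>R 1 \<le> Q" "Q \<le> d *\<^sub>R 1"
    using positive_invertible_bounds[OF assms] .
  define T where "T = 1 - (1/d) *\<^sub>R Q"
  define q where "q = norm T"
  have q: "0 \<le> q" "q < 1"
    using norm_one_minus_scaled_lt_1(1)[OF cd(3,4,1,2)] by (simp_all add: q_def T_def)
  have T_adj: "bop_adjoint T = T"
    using norm_one_minus_scaled_lt_1(2)[OF cd(3,4,1,2)]
    unfolding T_def by (rule bop_positive_adjoint)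
  define \<S> where "\<S> = cball 0 q \<inter> {A :: 'h bop. bop_adjoint A = A}"
  define F where "F S = (1/2) *\<^sub>R (T + S * S)" for S
  have "\<exists>!S\<in>\<S>. F S = S"
  proof (rule Banach_fix[OF _ _ q])
    show "complete \<S>"
      unfolding \<S>_def by (simp add: complete_eq_closed closed_Int closed_self_adjoint)
    show "\<S> \<noteq> {}"
      using T_adj by (auto simp: \<S>_def q_def)
    show "F ` \<S> \<subseteq> \<S>"
    proof safe
      fix S assume "S \<in> \<S>"
      then have nS: "norm S \<le> q" and adj: "bop_adjoint S = S"
        by (simp_all add: \<S>_def)
      have "norm (S * S) \<le> q * q"
        using norm_mult_ineq[of S S] mult_mono[OF nS nS] q by fastforce
      also have "\<dots> \<le> 1 * q"
        using q by (intro mult_right_mono) simp_all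
      finally have "norm (T + S * S) \<le> q + q"
        using norm_triangle_ineq[of T "S * S"] by (simp add: q_def)
      moreover have "bop_adjoint (F S) = F S"
        by (rule bop_adjoint_eqI)
          (simp add: F_def cinner_scaleR_left cinner_scaleR_right cinner_add_left
            cinner_add_right cinner_bop_adjoint adj T_adj scaleR_add_right)
      ultimately show "F S \<in> \<S>"
        by (simp add: \<S>_def F_def)
    qed
    show "dist (F A) (F B) \<le> q * dist A B" if "A \<in> \<S>" "B \<in> \<S>" for A B
    proof -
      have n: "norm A \<le> q" "norm B \<le> q"
        using that by (simp_all add: \<S>_def)
      \<comment> \<open>The noncommutative difference of squares; each of the two products
        contributes a factor at most \<open>q\<close>, which the 1/2 averages.\<close>
      have "F A - F B = (1/2) *\<^sub>R (A * (A - B) + (A - B) * B)"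
        by (simp add: F_def algebra_simps)
      then have "dist (F A) (F B) = norm (A * (A - B) + (A - B) * B) / 2"
        by (simp add: dist_norm)
      also have "norm (A * (A - B) + (A - B) * B) \<le> norm A * norm (A - B) + norm (A - B) * norm B"
        by (intro norm_triangle_le add_mono norm_mult_ineq)
      also have "\<dots> \<le> q * norm (A - B) + norm (A - B) * q"
        by (intro add_mono mult_right_mono mult_left_mono n norm_ge_zero)
      finally show ?thesis
        by (simp add: dist_norm mult.commute)
    qed
  qed
  then obtain S where S: "F S = S" "bop_adjoint S = S"
    unfolding \<S>_def by blast
  have "T + S * S = S + S"
    using arg_cong[OF S(1), of "\<lambda>X. 2 *\<^sub>R X"] by (simp add: F_def scaleR_2)
  then have sq: "(1 - S) * (1 - S) = (1/d) *\<^sub>R Q"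
    by (simp add: T_def algebra_simps)
  define R where "R = sqrt d *\<^sub>R (1 - S)"
  have RR: "R * R = Q"
    using cd by (simp add: R_def sq)
  obtain B where B: "Q * B = 1" "B * Q = 1"
    using assms(2) by (auto simp: bop_invertible_def)
  \<comment> \<open>Since \<open>R * R = Q\<close>, the inverse \<open>B\<close> of \<open>Q\<close>
    yields a right inverse \<open>R * B\<close> and a left inverse \<open>B * R\<close>, which
    coincide.\<close>
  have "R * (R * B) = 1"
    using B by (simp add: RR flip: mult.assoc)
  moreover have "(B * R) * R = 1"
    using B by (simp add: RR mult.assoc)
  moreover from calculation have "B * R = R * B"
    by (metis mult.assoc mult_1_left mult_1_right)
  ultimately have "bop_invertible R"
    unfolding bop_invertible_def by metis
  moreover have "bop_adjoint R = R"
    by (rule bop_adjoint_eqI)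
      (simp add: R_def cinner_scaleR_left cinner_scaleR_right cinner.diff_left cinner.diff_right
        cinner_bop_adjoint S(2))
  ultimately show thesis
    using RR that by blast
qed


section \<open>The weak-star topology on bounded sets\<close>

lemma openin_weak_star_normal_functional:
  assumes "summable (\<lambda>n. (norm (\<xi> n))\<^sup>2)" "summable (\<lambda>n. (norm (\<eta> n))\<^sup>2)" "open U"
  shows "openin weak_star (normal_functional \<xi> \<eta> -` U)"
  unfolding weak_star_def using assms by (intro topology_generated_by_Basis) blast

lemma topspace_weak_star [simp]:
  "topspace (weak_star :: 'h::complex_hilbert_space bop topology) = UNIV"
proof -
  have "openin weak_star (normal_functional (\<lambda>_. 0 :: 'h) (\<lambda>_. 0) -` UNIV)"
    by (rule openin_weak_star_normal_functional) simp_all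
  then show ?thesis
    using openin_subset by fastforce
qed

lemma continuous_map_weak_starI:
  assumes "\<And>\<xi> \<eta> U. \<lbrakk>summable (\<lambda>n. (norm (\<xi> n))\<^sup>2); summable (\<lambda>n. (norm (\<eta> n))\<^sup>2); open U\<rbrakk>
    \<Longrightarrow> openin weak_star (f -` (normal_functional \<xi> \<eta> -` U))"
  shows "continuous_map weak_star (weak_star :: 'h::complex_hilbert_space bop topology) f"
proof -
  have "\<Union> {normal_functional \<xi> \<eta> -` U | (\<xi> :: nat \<Rightarrow> 'h) \<eta> U.
      summable (\<lambda>n. (norm (\<xi> n))\<^sup>2) \<and> summable (\<lambda>n. (norm (\<eta> n))\<^sup>2) \<and> open U} = UNIV"
    using topspace_weak_star unfolding weak_star_def topology_generated_by_topspace .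
  then show ?thesis
    unfolding weak_star_def[where 'h = 'h] continuous_on_generated_topo_iff
    using assms by (auto simp flip: weak_star_def)
qed

text \<open>Conjugation turns a normal functional into another one: \<open>B\<close> moves onto the
  first sequence and the adjoint of \<open>A\<close> onto the second, and bounded operators preserve
  square-summability.\<close>

lemma continuous_map_weak_star_conjugation:
  "continuous_map weak_star weak_star (\<lambda>X. A * X * (B :: 'h::complex_hilbert_space bop))"
proof (rule continuous_map_weak_starI)
  fix \<xi> \<eta> :: "nat \<Rightarrow> 'h" and U :: "complex set"
  assume \<xi>: "summable (\<lambda>n. (norm (\<xi> n))\<^sup>2)" and \<eta>: "summable (\<lambda>n. (norm (\<eta> n))\<^sup>2)" and "open U"
  have summable_apply: "summable (\<lambda>n. (norm (C \<cdot> \<zeta> n))\<^sup>2)"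
    if "summable (\<lambda>n. (norm (\<zeta> n))\<^sup>2)" for C :: "'h bop" and \<zeta>
  proof (rule summable_comparison_test'[where N = 0])
    show "summable (\<lambda>n. (norm C)\<^sup>2 * (norm (\<zeta> n))\<^sup>2)"
      using that by (rule summable_mult)
    show "norm ((norm (C \<cdot> \<zeta> n))\<^sup>2) \<le> (norm C)\<^sup>2 * (norm (\<zeta> n))\<^sup>2" for n
      using power_mono[OF norm_bop_apply norm_ge_zero, of C "\<zeta> n" 2]
      by (simp add: power_mult_distrib)
  qed
  have "normal_functional \<xi> \<eta> (A * X * B)
      = normal_functional (\<lambda>n. B \<cdot> \<xi> n) (\<lambda>n. bop_adjoint A \<cdot> \<eta> n) X" for X
    by (simp add: normal_functional_def cinner_bop_adjoint)
  then have "(\<lambda>X. A * X * B) -` (normal_functional \<xi> \<eta> -` U)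
      = normal_functional (\<lambda>n. B \<cdot> \<xi> n) (\<lambda>n. bop_adjoint A \<cdot> \<eta> n) -` U"
    by auto
  then show "openin weak_star ((\<lambda>X. A * X * B) -` (normal_functional \<xi> \<eta> -` U))"
    using openin_weak_star_normal_functional[OF summable_apply[OF \<xi>] summable_apply[OF \<eta>] \<open>open U\<close>]
    by simp
qed

text \<open>On norm-bounded families convergence of matrix coefficients is enough: the series of a
  normal functional is dominated by \<open>D\<close> times the summable products of norms, so limit
  and sum may be exchanged.\<close>

lemma limitin_weak_starI:
  fixes Q :: "'h::complex_hilbert_space bop"
  assumes "F \<noteq> bot" and bound: "\<And>i. norm (X i) \<le> D"
    and lim: "\<And>x y. ((\<lambda>i. cinner (X i \<cdot> x) y) \<longlongrightarrow> cinner (Q \<cdot> x) y) F"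
  shows "limitin weak_star X Q F"
proof -
  let ?S = "{normal_functional \<xi> \<eta> -` U | (\<xi> :: nat \<Rightarrow> 'h) \<eta> U.
      summable (\<lambda>n. (norm (\<xi> n))\<^sup>2) \<and> summable (\<lambda>n. (norm (\<eta> n))\<^sup>2) \<and> open U}"
  have normal: "((\<lambda>i. normal_functional \<xi> \<eta> (X i)) \<longlongrightarrow> normal_functional \<xi> \<eta> Q) F"
    if \<xi>: "summable (\<lambda>n. (norm (\<xi> n))\<^sup>2)" and \<eta>: "summable (\<lambda>n. (norm (\<eta> n))\<^sup>2)" for \<xi> \<eta>
  proof -
    define M where "M n = D * (norm (\<xi> n) * norm (\<eta> n))" for n
    have "summable (\<lambda>n. norm (\<xi> n) * norm (\<eta> n))"
    proof (rule summable_comparison_test'[where N = 0])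
      show "summable (\<lambda>n. (norm (\<xi> n))\<^sup>2 + (norm (\<eta> n))\<^sup>2)"
        using \<xi> \<eta> by (rule summable_add)
      show "norm (norm (\<xi> n) * norm (\<eta> n)) \<le> (norm (\<xi> n))\<^sup>2 + (norm (\<eta> n))\<^sup>2" for n
      proof -
        have "0 \<le> norm (\<xi> n) * norm (\<eta> n)"
          by simp
        with sum_squares_bound[of "norm (\<xi> n)" "norm (\<eta> n)"] show ?thesis
          unfolding real_norm_def abs_of_nonneg[OF \<open>0 \<le> norm (\<xi> n) * norm (\<eta> n)\<close>] by linarith
      qed
    qed
    then have M: "summable M"
      unfolding M_def by (rule summable_mult)
    have "norm (cinner (X i \<cdot> \<xi> n) (\<eta> n)) \<le> M n" for i n
    proof -
      have "norm (cinner (X i \<cdot> \<xi> n) (\<eta> n)) \<le> norm (X i \<cdot> \<xi> n) * norm (\<eta> n)"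
        by (rule norm_cinner_le)
      also have "\<dots> \<le> (D * norm (\<xi> n)) * norm (\<eta> n)"
        by (intro mult_right_mono order_trans[OF norm_bop_apply] bound) simp_all
      finally show ?thesis
        by (simp add: M_def mult.assoc)
    qed
    then have "\<forall>\<^sub>F (n, i) in at_top \<times>\<^sub>F F. norm (cinner (X i \<cdot> \<xi> n) (\<eta> n)) \<le> M n"
      by (intro always_eventually) auto
    from tannerys_theorem[OF lim this M \<open>F \<noteq> bot\<close>] show ?thesis
      unfolding normal_functional_def by blast
  qed
  \<comment> \<open>The topology is given by generators, so the claim is carried from them to all
    open sets by induction.\<close>
  have "Q \<in> U \<longrightarrow> (\<forall>\<^sub>F i in F. X i \<in> U)" if "generate_topology_on ?S U" for U
    using that
  proof induction
    case (UN K)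
    show ?case
    proof
      assume "Q \<in> \<Union> K"
      then obtain k where "k \<in> K" "Q \<in> k"
        by blast
      then have "\<forall>\<^sub>F i in F. X i \<in> k"
        using UN by blast
      then show "\<forall>\<^sub>F i in F. X i \<in> \<Union> K"
        by (rule eventually_mono) (use \<open>k \<in> K\<close> in blast)
    qed
  next
    case (Basis s)
    then obtain \<xi> \<eta> :: "nat \<Rightarrow> 'h" and U where s: "s = normal_functional \<xi> \<eta> -` U"
      "summable (\<lambda>n. (norm (\<xi> n))\<^sup>2)" "summable (\<lambda>n. (norm (\<eta> n))\<^sup>2)" "open U"
      by blast
    then show ?case
      using topological_tendstoD[OF normal[OF s(2,3)] s(4)] by simp
  qed (auto intro: eventually_conj)
  then show ?thesis
    by (simp add: limitin_def) (simp add: weak_star_def openin_topology_generated_by_iff)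
qed

text \<open>A matrix coefficient is itself a normal functional, with both sequences concentrated at
  index 0.\<close>

lemma limitin_weak_star_cinner:
  assumes "limitin weak_star X Q F"
  shows "((\<lambda>i. cinner (X i \<cdot> x) y) \<longlongrightarrow> cinner (Q \<cdot> x) y) F"
proof (rule topological_tendstoI)
  let ?\<xi> = "\<lambda>n::nat. if n = 0 then x else 0" and ?\<eta> = "\<lambda>n::nat. if n = 0 then y else 0"
  have rank_one: "normal_functional ?\<xi> ?\<eta> A = cinner (A \<cdot> x) y" for A
    unfolding normal_functional_def by (subst suminf_finite[of "{0}"]) simp_all
  have summable: "summable (\<lambda>n::nat. (norm (if n = 0 then z else 0))\<^sup>2)" for z :: 'a
    by (rule summable_finite[of "{0}"]) simp_all
  fix U assume "open U" "cinner (Q \<cdot> x) y \<in> U"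
  then have "openin weak_star (normal_functional ?\<xi> ?\<eta> -` U)" "Q \<in> normal_functional ?\<xi> ?\<eta> -` U"
    by (auto intro!: openin_weak_star_normal_functional summable simp: rank_one)
  with assms have "\<forall>\<^sub>F i in F. X i \<in> normal_functional ?\<xi> ?\<eta> -` U"
    unfolding limitin_def by blast
  then show "\<forall>\<^sub>F i in F. cinner (X i \<cdot> x) y \<in> U"
    by (simp add: rank_one)
qed

text \<open>The cluster point comes from Tychonoff's theorem, applied to the sesquilinear forms of
  the operators \<open>X n\<close>.\<close>

lemma bounded_sequence_weak_cluster_point:
  fixes X :: "nat \<Rightarrow> 'h::complex_hilbert_space bop"
  assumes bound: "\<And>n. norm (X n) \<le> D"
  obtains Q F where "F \<le> sequentially" "F \<noteq> bot"
    "\<And>x y. ((\<lambda>n. cinner (X n \<cdot> x) y) \<longlongrightarrow> cinner (Q \<cdot> x) y) F"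
proof -
  define m where "m n p = cinner (X n \<cdot> fst p) (snd p)" for n and p :: "'h \<times> 'h"
  define K where "K = (\<Pi>\<^sub>E p\<in>UNIV. cball (0 :: complex) (D * norm (fst p :: 'h) * norm (snd p :: 'h)))"
  have "compactin (product_topology (\<lambda>_. euclidean) UNIV) K"
    unfolding K_def compactin_PiE by simp
  then have "compact K"
    by (simp add: euclidean_product_topology)
  have m_bound: "norm (m n p) \<le> D * norm (fst p) * norm (snd p)" for n p
  proof -
    have "norm (m n p) \<le> norm (X n \<cdot> fst p) * norm (snd p)"
      unfolding m_def by (rule norm_cinner_le)
    also have "\<dots> \<le> (D * norm (fst p)) * norm (snd p)"
      by (intro mult_right_mono order_trans[OF norm_bop_apply] bound) simp_all
    finally show ?thesis .
  qed
  then have "eventually (\<lambda>f. f \<in> K) (filtermap m sequentially)"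
    by (simp add: eventually_filtermap K_def PiE_iff del: split_paired_All)
  moreover have "filtermap m sequentially \<noteq> bot"
    by (simp add: filtermap_bot_iff)
  ultimately obtain f where "f \<in> K" and f: "inf (nhds f) (filtermap m sequentially) \<noteq> bot"
    using \<open>compact K\<close> unfolding compact_filter by blast
  \<comment> \<open>Pulling the neighbourhoods of \<open>f\<close> back to indices turns the cluster
    point into a limit along a filter. A product over all pairs of vectors need not be metrizable,
    so a subsequence is not at hand.\<close>
  define F where "F = inf (filtercomap m (nhds f)) sequentially"
  have "F \<noteq> bot"
  proof
    assume "F = bot"
    then have "eventually (\<lambda>_. False) F"
      by simp
    then obtain P R where "eventually P (nhds f)" "eventually R sequentially"
      and PR: "\<And>n. \<not> (P (m n) \<and> R n)"
      unfolding F_def eventually_inf eventually_filtercomap by blast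
    then have "eventually (\<lambda>g. \<not> P g) (filtermap m sequentially)"
      unfolding eventually_filtermap by (auto elim: eventually_mono)
    with \<open>eventually P (nhds f)\<close> have "eventually (\<lambda>_. False) (inf (nhds f) (filtermap m sequentially))"
      unfolding eventually_inf by blast
    with f show False
      by (simp add: trivial_limit_def)
  qed
  have "filterlim m (nhds f) F"
    unfolding F_def by (rule filterlim_mono[OF filterlim_filtercomap order_refl inf_le1])
  then have lim: "((\<lambda>n. cinner (X n \<cdot> x) y) \<longlongrightarrow> f (x, y)) F" for x y
    using continuous_on_tendsto_compose[OF continuous_on_product_coordinates[of "(x, y)"], of m f F]
    by (simp add: m_def)
  \<comment> \<open>The limit form inherits each sesquilinearity identity, since both sides are
    limits of the same coefficients.\<close>
  note unique = tendsto_unique[OF \<open>F \<noteq> bot\<close> lim]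
  have "\<exists>Q. \<forall>x y. cinner (Q \<cdot> x) y = f (x, y)"
  proof (rule sesquilinear_form_representation)
    show "f (x + y, z) = f (x, z) + f (y, z)" for x y z
      by (rule unique) (simp add: cinner_add_left tendsto_add lim)
    show "f (c *\<^sub>C x, z) = c * f (x, z)" for c x z
      by (rule unique) (simp add: cinner_scaleC_left tendsto_mult lim)
    show "f (x, y + z) = f (x, y) + f (x, z)" for x y z
      by (rule unique) (simp add: cinner_add_right tendsto_add lim)
    show "f (x, c *\<^sub>C z) = cnj c * f (x, z)" for c x z
      by (rule unique) (simp add: cinner_scaleC_right tendsto_mult lim)
    show "norm (f (x, y)) \<le> D * norm x * norm y" for x y
      using \<open>f \<in> K\<close> by (auto simp: K_def PiE_iff)
  qed
  then obtain Q where "\<And>x y. cinner (Q \<cdot> x) y = f (x, y)"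
    by blast
  with lim \<open>F \<noteq> bot\<close> show thesis
    by (intro that[of F Q]) (simp_all add: F_def)
qed

lemma weak_limit_lower_bound:
  assumes "F \<noteq> bot" "\<And>i. A \<le> X i"
    and lim: "\<And>x y. ((\<lambda>i. cinner (X i \<cdot> x) y) \<longlongrightarrow> cinner (Q \<cdot> x) y) F"
  shows "A \<le> Q"
  unfolding less_eq_bop_def bop_positive_def
proof
  fix x
  have "cinner ((Q - A) \<cdot> x) x \<in> {z. Im z = 0} \<inter> {z. 0 \<le> Re z}"
  proof (rule Lim_in_closed_set)
    show "closed ({z. Im z = 0} \<inter> {z. 0 \<le> Re z})"
      by (intro closed_Int closed_Collect_eq closed_Collect_le continuous_intros)
    show "((\<lambda>i. cinner ((X i - A) \<cdot> x) x) \<longlongrightarrow> cinner ((Q - A) \<cdot> x) x) F"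
      by (simp add: cinner.diff_left) (intro tendsto_intros lim)
    show "\<forall>\<^sub>F i in F. cinner ((X i - A) \<cdot> x) x \<in> {z. Im z = 0} \<inter> {z. 0 \<le> Re z}"
      using assms(2) by (simp add: less_eq_bop_def bop_positive_def complex_is_Real_iff)
  qed fact
  then show "cinner ((Q - A) \<cdot> x) x \<in> \<real> \<and> 0 \<le> Re (cinner ((Q - A) \<cdot> x) x)"
    by (simp add: complex_is_Real_iff)
qed


section \<open>Positive linear maps and commuting tuples\<close>

lemma positive_linear_map_linear:
  assumes "positive_linear_map \<phi>"
  shows "\<phi> (X + Y) = \<phi> X + \<phi> Y" "\<phi> (X - Y) = \<phi> X - \<phi> Y"
    "\<phi> (c *\<^sub>C X) = c *\<^sub>C \<phi> X" "\<phi> (r *\<^sub>R X) = r *\<^sub>R \<phi> X" "\<phi> (sum g S) = (\<Sum>s\<in>S. \<phi> (g s))"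
proof -
  have linear: "Vector_Spaces.linear scaleC scaleC \<phi>"
    using assms by (simp add: positive_linear_map_def)
  show add: "\<phi> (X + Y) = \<phi> X + \<phi> Y" and scaleC: "\<phi> (c *\<^sub>C X) = c *\<^sub>C \<phi> X" for X Y c
    using linear by (simp_all add: Vector_Spaces.linear_iff)
  show "\<phi> (r *\<^sub>R X) = r *\<^sub>R \<phi> X"
    using scaleC[of "complex_of_real r" X] by (simp add: scaleC_of_real)
  interpret additive \<phi>
    by standard (rule add)
  show "\<phi> (X - Y) = \<phi> X - \<phi> Y" "\<phi> (sum g S) = (\<Sum>s\<in>S. \<phi> (g s))"
    by (rule diff sum)+
qed

lemma positive_linear_mapI:
  assumes "\<And>X Y. \<phi> (X + Y) = \<phi> X + \<phi> Y" "\<And>c X. \<phi> (c *\<^sub>C X) = c *\<^sub>C \<phi> X"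
    and "\<And>X. 0 \<le> X \<Longrightarrow> 0 \<le> \<phi> X"
  shows "positive_linear_map \<phi>"
  using assms by (simp add: positive_linear_map_def Vector_Spaces.linear_iff vector_space_scaleC)

lemma positive_linear_map_nonneg: "positive_linear_map \<phi> \<Longrightarrow> 0 \<le> X \<Longrightarrow> 0 \<le> \<phi> X"
  by (simp add: positive_linear_map_def)

lemma positive_linear_map_mono:
  assumes "positive_linear_map \<phi>" "X \<le> Y"
  shows "\<phi> X \<le> \<phi> Y"
  using positive_linear_map_nonneg[OF assms(1), of "Y - X"] assms(2)
  by (simp add: positive_linear_map_linear(2)[OF assms(1)])

lemma positive_linear_map_comp:
  "positive_linear_map \<phi> \<Longrightarrow> positive_linear_map \<psi> \<Longrightarrow> positive_linear_map (\<phi> \<circ> \<psi>)"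
  by (rule positive_linear_mapI) (simp_all add: positive_linear_map_linear positive_linear_map_nonneg)

lemma positive_linear_map_funpow:
  "positive_linear_map \<phi> \<Longrightarrow> positive_linear_map (\<phi> ^^ n)"
  by (induction n) (simp_all add: positive_linear_map_comp, simp add: positive_linear_mapI)

section \<open>Composites of powers of commuting maps\<close>

lemma comp_powers_simps [simp]:
  "comp_powers \<Phi> s [] = id"
  "comp_powers \<Phi> s (j # js) = (\<Phi> j ^^ s j) \<circ> comp_powers \<Phi> s js"
  by (simp_all add: comp_powers_def)

lemma comp_powers_append: "comp_powers \<Phi> s (is @ js) = comp_powers \<Phi> s is \<circ> comp_powers \<Phi> s js"
  by (induction "is") (simp_all add: comp_assoc)

lemma comp_powers_cong:
  "(\<And>i. i \<in> set js \<Longrightarrow> s i = t i) \<Longrightarrow> comp_powers \<Phi> s js = comp_powers \<Phi> t js"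
  by (induction js) simp_all

lemma positive_linear_map_comp_powers:
  "(\<And>i. i \<in> set js \<Longrightarrow> positive_linear_map (\<Phi> i)) \<Longrightarrow> positive_linear_map (comp_powers \<Phi> s js)"
  by (induction js)
    (simp add: positive_linear_mapI, simp add: positive_linear_map_comp positive_linear_map_funpow)

lemma comp_funpow_commute: "f \<circ> g = g \<circ> f \<Longrightarrow> f \<circ> (g ^^ n) = (g ^^ n) \<circ> f"
proof (induction n)
  case (Suc n)
  have "f \<circ> (g ^^ Suc n) = (f \<circ> g) \<circ> (g ^^ n)"
    by (simp add: comp_assoc)
  also have "\<dots> = g \<circ> (f \<circ> (g ^^ n))"
    by (simp only: Suc.prems comp_assoc)
  also have "\<dots> = (g ^^ Suc n) \<circ> f"
    by (simp only: Suc.IH[OF Suc.prems] funpow.simps comp_assoc)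
  finally show ?case .
qed simp

lemma comp_powers_commute:
  "(\<And>j. j \<in> set js \<Longrightarrow> f \<circ> \<Phi> j = \<Phi> j \<circ> f) \<Longrightarrow> f \<circ> comp_powers \<Phi> s js = comp_powers \<Phi> s js \<circ> f"
proof (induction js)
  case (Cons j js)
  have "f \<circ> comp_powers \<Phi> s (j # js) = (f \<circ> (\<Phi> j ^^ s j)) \<circ> comp_powers \<Phi> s js"
    by (simp add: comp_assoc)
  also have "\<dots> = (\<Phi> j ^^ s j) \<circ> (f \<circ> comp_powers \<Phi> s js)"
    using comp_funpow_commute[OF Cons.prems[of j], of "s j"] by (simp add: comp_assoc)
  also have "f \<circ> comp_powers \<Phi> s js = comp_powers \<Phi> s js \<circ> f"
    by (intro Cons.IH Cons.prems) simp
  also have "(\<Phi> j ^^ s j) \<circ> \<dots> = comp_powers \<Phi> s (j # js) \<circ> f"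
    by (simp add: comp_assoc)
  finally show ?case .
qed simp

text \<open>Reconciles the opposite orders of composition in the power bounds and in the
  means.\<close>

lemma comp_powers_rev:
  assumes "\<And>i j. i \<in> set js \<Longrightarrow> j \<in> set js \<Longrightarrow> \<Phi> i \<circ> \<Phi> j = \<Phi> j \<circ> \<Phi> i"
  shows "comp_powers \<Phi> s (rev js) = comp_powers \<Phi> s js"
  using assms
proof (induction js)
  case (Cons j js)
  have "(\<Phi> j ^^ s j) \<circ> \<Phi> i = \<Phi> i \<circ> (\<Phi> j ^^ s j)" if "i \<in> set js" for i
    using that by (intro comp_funpow_commute[symmetric] Cons.prems) simp_all
  then have "comp_powers \<Phi> s js \<circ> (\<Phi> j ^^ s j) = (\<Phi> j ^^ s j) \<circ> comp_powers \<Phi> s js"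
    by (rule comp_powers_commute[symmetric])
  moreover have "comp_powers \<Phi> s (rev js) = comp_powers \<Phi> s js"
    by (intro Cons.IH Cons.prems) simp_all
  ultimately show ?case
    by (simp add: comp_powers_append)
qed simp

text \<open>Commutativity makes the exponent tuples act as an additive semigroup, so that applying a
  composite translates exponents.\<close>

lemma comp_powers_add:
  assumes "\<And>i j. i \<in> set js \<Longrightarrow> j \<in> set js \<Longrightarrow> \<Phi> i \<circ> \<Phi> j = \<Phi> j \<circ> \<Phi> i"
  shows "comp_powers \<Phi> (\<lambda>i. s i + t i) js = comp_powers \<Phi> s js \<circ> comp_powers \<Phi> t js"
  using assms
proof (induction js)
  case (Cons j js)
  have "(\<Phi> j ^^ t j) \<circ> \<Phi> i = \<Phi> i \<circ> (\<Phi> j ^^ t j)" if "i \<in> set js" for i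
    using that by (intro comp_funpow_commute[symmetric] Cons.prems) simp_all
  then have "(\<Phi> j ^^ t j) \<circ> comp_powers \<Phi> s js = comp_powers \<Phi> s js \<circ> (\<Phi> j ^^ t j)"
    by (rule comp_powers_commute)
  then have "(\<Phi> j ^^ t j) (comp_powers \<Phi> s js X) = comp_powers \<Phi> s js ((\<Phi> j ^^ t j) X)" for X
    by (metis comp_apply)
  moreover have "comp_powers \<Phi> (\<lambda>i. s i + t i) js = comp_powers \<Phi> s js \<circ> comp_powers \<Phi> t js"
    by (intro Cons.IH Cons.prems) simp_all
  ultimately show ?case
    by (simp add: fun_eq_iff funpow_add)
qed simp

lemma comp_powers_single:
  assumes "distinct js" "i \<in> set js"
  shows "comp_powers \<Phi> (\<lambda>j. if j = i then 1 else 0) js = \<Phi> i"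
  using assms
proof (induction js)
  case (Cons j js)
  have zero: "comp_powers \<Phi> (\<lambda>j. 0) ls = id" for ls
    by (induction ls) simp_all
  show ?case
  proof (cases "j = i")
    case True
    with Cons.prems have "comp_powers \<Phi> (\<lambda>j. if j = i then 1 else 0) js = comp_powers \<Phi> (\<lambda>j. 0) js"
      by (intro comp_powers_cong) auto
    with True show ?thesis
      by (simp add: zero)
  qed (use Cons in simp)
qed simp

section \<open>Orbits of the identity and their sums over boxes\<close>

locale commuting_positive =
  fixes k :: nat and \<Phi> :: "nat \<Rightarrow> 'h::complex_hilbert_space bop \<Rightarrow> 'h bop"
  assumes tuple: "commuting_positive_tuple k \<Phi>"
begin

definition orbit :: "(nat \<Rightarrow> nat) \<Rightarrow> 'h bop \<Rightarrow> 'h bop" where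
  "orbit s = comp_powers \<Phi> s [1..<k+1]"

text \<open>Sides are arbitrary sets, not lengths, so that translated boxes and single faces are
  again of this form. Extensionality of \<open>Pi\<^sub>E\<close> counts each exponent tuple
  once.\<close>

definition box_sum :: "(nat \<Rightarrow> nat set) \<Rightarrow> 'h bop" where
  "box_sum A = (\<Sum>s\<in>Pi\<^sub>E {1..k} A. orbit s 1)"

lemma positive: "i \<in> {1..k} \<Longrightarrow> positive_linear_map (\<Phi> i)"
  and weak_star_continuous: "i \<in> {1..k} \<Longrightarrow> continuous_map weak_star weak_star (\<Phi> i)"
  and commute: "i \<in> {1..k} \<Longrightarrow> j \<in> {1..k} \<Longrightarrow> \<Phi> i \<circ> \<Phi> j = \<Phi> j \<circ> \<Phi> i"
  using tuple by (auto simp: commuting_positive_tuple_def)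

lemma set_upt_eq: "set [1..<k+1] = {1..k}"
  by auto

lemma comp_powers_rev_eq_orbit: "comp_powers \<Phi> s (rev [1..<k+1]) = orbit s"
  unfolding orbit_def by (rule comp_powers_rev) (simp add: commute del: upt_Suc)

lemma orbit_cong: "(\<And>i. i \<in> {1..k} \<Longrightarrow> s i = t i) \<Longrightarrow> orbit s = orbit t"
  unfolding orbit_def by (rule comp_powers_cong) (simp del: upt_Suc)

lemma positive_orbit: "positive_linear_map (orbit s)"
  unfolding orbit_def by (rule positive_linear_map_comp_powers) (simp add: positive del: upt_Suc)

lemma orbit_add: "orbit (\<lambda>i. s i + t i) X = orbit s (orbit t X)"
  unfolding orbit_def by (subst comp_powers_add) (simp_all add: commute del: upt_Suc)

lemma \<Phi>_orbit:
  assumes "i \<in> {1..k}"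
  shows "\<Phi> i (orbit s X) = orbit (s(i := Suc (s i))) X"
proof -
  have "\<Phi> i = orbit (\<lambda>j. if j = i then 1 else 0)"
    unfolding orbit_def using assms by (subst comp_powers_single) (auto simp del: upt_Suc)
  then have "\<Phi> i (orbit s X) = orbit (\<lambda>j. (if j = i then 1 else 0) + s j) X"
    by (simp add: orbit_add)
  also have "\<dots> = orbit (s(i := Suc (s i))) X"
    by (subst orbit_cong[of _ "s(i := Suc (s i))"]) simp_all
  finally show ?thesis .
qed

lemma orbit_one_nonneg: "0 \<le> orbit s 1"
  by (rule positive_linear_map_nonneg[OF positive_orbit])
    (use bop_scaleR_one_mono[of 0 1] in simp)

lemma orbit_fixed_point:
  assumes "\<And>i. i \<in> {1..k} \<Longrightarrow> \<Phi> i Q = Q"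
  shows "orbit s Q = Q"
proof -
  have "comp_powers \<Phi> s js Q = Q" if "set js \<subseteq> {1..k}" for js
    using that
  proof (induction js)
    case (Cons j js)
    moreover have "(\<Phi> j ^^ n) Q = Q" for n
      using Cons.prems by (induction n) (simp_all add: assms)
    ultimately show ?case
      by simp
  qed simp
  then show ?thesis
    unfolding orbit_def set_upt_eq[symmetric] by blast
qed

lemma box_sum_nonneg: "0 \<le> box_sum A"
  unfolding box_sum_def by (rule sum_nonneg) (rule orbit_one_nonneg)

lemma box_sum_bounds:
  shows "(\<And>s. orbit s 1 \<le> d *\<^sub>R 1) \<Longrightarrow> box_sum A \<le> (real (\<Prod>i=1..k. card (A i)) * d) *\<^sub>R 1"
    and "(\<And>s. c *\<^sub>R 1 \<le> orbit s 1) \<Longrightarrow> (real (\<Prod>i=1..k. card (A i)) * c) *\<^sub>R 1 \<le> box_sum A"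
proof -
  have const: "(\<Sum>s\<in>Pi\<^sub>E {1..k} A. r *\<^sub>R 1) = (real (\<Prod>i=1..k. card (A i)) * r) *\<^sub>R (1 :: 'h bop)" for r
    by (subst sum_constant_scaleR) (simp add: card_PiE)
  show "box_sum A \<le> (real (\<Prod>i=1..k. card (A i)) * d) *\<^sub>R 1" if "\<And>s. orbit s 1 \<le> d *\<^sub>R 1"
    unfolding box_sum_def const[symmetric] by (rule sum_mono) (rule that)
  show "(real (\<Prod>i=1..k. card (A i)) * c) *\<^sub>R 1 \<le> box_sum A" if "\<And>s. c *\<^sub>R 1 \<le> orbit s 1"
    unfolding box_sum_def const[symmetric] by (rule sum_mono) (rule that)
qed

lemma \<Phi>_box_sum:
  assumes "i \<in> {1..k}"
  shows "\<Phi> i (box_sum A) = box_sum (A(i := Suc ` A i))"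
proof -
  have "\<Phi> i (box_sum A) = (\<Sum>s\<in>Pi\<^sub>E {1..k} A. orbit (s(i := Suc (s i))) 1)"
    unfolding box_sum_def
    by (simp add: positive_linear_map_linear(5)[OF positive[OF assms]] \<Phi>_orbit[OF assms])
  also have "\<dots> = box_sum (A(i := Suc ` A i))"
    unfolding box_sum_def
    by (rule sum.reindex_bij_witness[where i = "\<lambda>s. s(i := s i - 1)" and j = "\<lambda>s. s(i := Suc (s i))"])
      (use assms in \<open>auto simp: PiE_iff extensional_def intro!: fun_upd_idem split: if_splits\<close>)
  finally show ?thesis .
qed

lemma box_sum_Un:
  assumes "i \<in> {1..k}" "\<And>j. finite (A j)" "finite B" "finite C" "B \<inter> C = {}"
  shows "box_sum (A(i := B \<union> C)) = box_sum (A(i := B)) + box_sum (A(i := C))"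
proof -
  have mem: "s \<in> Pi\<^sub>E {1..k} (A(i := X)) \<longleftrightarrow>
      s i \<in> X \<and> s \<in> extensional {1..k} \<and> (\<forall>j\<in>{1..k} - {i}. s j \<in> A j)" for s X
    using assms(1) by (auto simp: PiE_iff)
  have "Pi\<^sub>E {1..k} (A(i := B \<union> C)) = Pi\<^sub>E {1..k} (A(i := B)) \<union> Pi\<^sub>E {1..k} (A(i := C))"
    unfolding set_eq_iff Un_iff mem by blast
  moreover have "Pi\<^sub>E {1..k} (A(i := B)) \<inter> Pi\<^sub>E {1..k} (A(i := C)) = {}"
    using assms(5) unfolding set_eq_iff Int_iff mem by blast
  ultimately show ?thesis
    unfolding box_sum_def using assms by (simp add: sum.union_disjoint finite_PiE)
qed

text \<open>Mean boundedness from both sides implies boundedness of the powers: the lower bound is used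
  for the mean over a box of the size of \<open>s\<close>, which \<open>orbit s\<close> maps into the box of twice the
  size, where the upper bound applies.\<close>

lemma mean_bounded_imp_power_bounded:
  assumes "0 < c"
    and lower: "\<And>p. (\<And>i. i \<in> {1..k} \<Longrightarrow> 1 \<le> p i) \<Longrightarrow>
      c *\<^sub>R 1 \<le> (1 / real (\<Prod>i=1..k. p i)) *\<^sub>R box_sum (\<lambda>i. {..<p i})"
    and upper: "\<And>p. (\<And>i. i \<in> {1..k} \<Longrightarrow> 1 \<le> p i) \<Longrightarrow>
      (1 / real (\<Prod>i=1..k. p i)) *\<^sub>R box_sum (\<lambda>i. {..<p i}) \<le> d *\<^sub>R 1"
  shows "orbit s 1 \<le> (2 ^ k * d / c) *\<^sub>R 1"
proof -
  \<comment> \<open>Side \<open>s i + 1\<close> is at least 1, as \<open>lower\<close> demands, and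
    exceeds \<open>s i\<close>, so the box translated by \<open>s\<close> fits into the doubled
    one.\<close>
  define p where "p i = Suc (s i)" for i
  define N where "N = real (\<Prod>i=1..k. p i)"
  have N: "0 < N"
    unfolding N_def of_nat_0_less_iff by (rule prod_pos) (simp add: p_def)
  \<comment> \<open>The restriction keeps the translated tuple extensional, hence a member of the
    doubled box.\<close>
  let ?h = "\<lambda>t. restrict (\<lambda>i. s i + t i) {1..k}"
  let ?P = "\<Pi>\<^sub>E i\<in>{1..k}. {..<p i}" and ?P2 = "\<Pi>\<^sub>E i\<in>{1..k}. {..<2 * p i}"
  have "inj_on ?h ?P"
  proof (rule inj_onI)
    fix t u assume "t \<in> ?P" "u \<in> ?P" and eq: "?h t = ?h u"
    have "s i + t i = s i + u i" if "i \<in> {1..k}" for i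
      using fun_cong[OF eq, of i] that by simp
    then show "t = u"
      by (intro PiE_ext[OF \<open>t \<in> ?P\<close> \<open>u \<in> ?P\<close>]) simp
  qed
  have "c *\<^sub>R orbit s 1 = orbit s (c *\<^sub>R 1)"
    by (simp add: positive_linear_map_linear(4)[OF positive_orbit])
  also have "\<dots> \<le> orbit s ((1 / N) *\<^sub>R box_sum (\<lambda>i. {..<p i}))"
    unfolding N_def by (intro positive_linear_map_mono[OF positive_orbit] lower) (simp add: p_def)
  also have "\<dots> = (1 / N) *\<^sub>R (\<Sum>t\<in>?P. orbit (?h t) 1)"
    unfolding box_sum_def positive_linear_map_linear(4,5)[OF positive_orbit] orbit_add[symmetric]
    by (intro arg_cong[of _ _ "(*\<^sub>R) _"] sum.cong refl fun_cong[OF orbit_cong]) simp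
  also have "(\<Sum>t\<in>?P. orbit (?h t) 1) = (\<Sum>u\<in>?h ` ?P. orbit u 1)"
    unfolding sum.reindex[OF \<open>inj_on ?h ?P\<close>] by (simp only: o_def)
  \<comment> \<open>The missing terms of the doubled box are positive, so adding them only increases
    the sum.\<close>
  also have "(1 / N) *\<^sub>R \<dots> \<le> (1 / N) *\<^sub>R box_sum (\<lambda>i. {..<2 * p i})"
    unfolding box_sum_def
  proof (intro bop_scaleR_mono sum_mono2)
    show "?h ` ?P \<subseteq> ?P2"
    proof (rule image_subsetI)
      fix t assume t: "t \<in> ?P"
      have "s i + t i < 2 * p i" if "i \<in> {1..k}" for i
        using PiE_mem[OF t that] by (simp add: p_def)
      then show "?h t \<in> ?P2"
        by (simp add: PiE_iff)
    qed
  qed (use N in \<open>simp_all add: finite_PiE orbit_one_nonneg\<close>)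
  \<comment> \<open>Renormalizing by the volume of the doubled box costs the factor
    \<open>2 ^ k\<close>.\<close>
  also have "\<dots> = 2 ^ k *\<^sub>R ((1 / real (\<Prod>i=1..k. 2 * p i)) *\<^sub>R box_sum (\<lambda>i. {..<2 * p i}))"
    by (simp add: prod.distrib N_def)
  also have "\<dots> \<le> 2 ^ k *\<^sub>R (d *\<^sub>R 1)"
    by (intro bop_scaleR_mono upper) (simp_all add: p_def)
  finally have "(1 / c) *\<^sub>R (c *\<^sub>R orbit s 1) \<le> (1 / c) *\<^sub>R (2 ^ k *\<^sub>R (d *\<^sub>R 1))"
    using \<open>0 < c\<close> by (intro bop_scaleR_mono) simp_all
  then show ?thesis
    using \<open>0 < c\<close> by simp
qed

text \<open>\<open>\<Phi> i\<close> translates the cube by one step in direction \<open>i\<close>.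
  Only the faces at 0 and at \<open>n\<close> remain; each has a share 1/n of the points, and each
  point contributes at most \<open>D\<close>.\<close>

lemma norm_\<Phi>_mean_diff_le:
  assumes bound: "\<And>s. orbit s 1 \<le> D *\<^sub>R 1" and "0 < D" "i \<in> {1..k}" "0 < n"
  defines "M \<equiv> (1 / real (\<Prod>i=1..k. n)) *\<^sub>R box_sum (\<lambda>_. {..<n})"
  shows "norm (\<Phi> i M - M) \<le> 2 * D / real n"
proof -
  let ?A = "\<lambda>_::nat. {..<n}"
  have split: "box_sum (?A(i := {..<Suc n})) = box_sum (?A(i := B)) + box_sum (?A(i := C))"
    if "{..<Suc n} = B \<union> C" "B \<inter> C = {}" for B C
    unfolding that(1)
    by (rule box_sum_Un) (use assms that in \<open>auto intro: finite_subset[OF _ finite_lessThan[of "Suc n"]]\<close>)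
  \<comment> \<open>The box with side \<open>n + 1\<close> in direction \<open>i\<close> is cut in
    two ways, removing its first or its last layer; comparing them performs the
    cancellation.\<close>
  have "box_sum (?A(i := {0})) + \<Phi> i (box_sum ?A) = box_sum (?A(i := {..<Suc n}))"
    unfolding \<Phi>_box_sum[OF \<open>i \<in> {1..k}\<close>]
    by (rule split[symmetric]) (auto simp: lessThan_Suc_eq_insert_0)
  also have "\<dots> = box_sum (?A(i := {..<n})) + box_sum (?A(i := {n}))"
    by (rule split) (auto simp: lessThan_Suc)
  finally have diff: "\<Phi> i (box_sum ?A) - box_sum ?A = box_sum (?A(i := {n})) - box_sum (?A(i := {0}))"
    by (simp add: algebra_simps fun_upd_idem)
  have card: "real (\<Prod>j=1..k. card ((?A(i := {a})) j)) = real (\<Prod>i=1..k. n) / real n" for a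
  proof -
    have "(\<Prod>j=1..k. card ((?A(i := {a})) j)) = (\<Prod>j\<in>{1..k} - {i}. n)"
      using \<open>i \<in> {1..k}\<close> by (subst prod.remove[of _ i]) (auto intro!: prod.cong)
    moreover have "(\<Prod>j=1..k. n) = n * (\<Prod>j\<in>{1..k} - {i}. n)"
      using \<open>i \<in> {1..k}\<close> by (subst prod.remove[of _ i]) simp_all
    ultimately show ?thesis
      using \<open>0 < n\<close> by (simp del: prod_constant)
  qed
  have face: "norm (box_sum (?A(i := {a}))) \<le> real (\<Prod>i=1..k. n) / real n * D" for a
  proof (rule positive_norm_le[OF box_sum_nonneg])
    show "box_sum (?A(i := {a})) \<le> (real (\<Prod>i=1..k. n) / real n * D) *\<^sub>R 1"
      using box_sum_bounds(1)[OF bound, of "?A(i := {a})"] unfolding card .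
  qed (use assms in simp)
  have "norm (\<Phi> i M - M) = norm (box_sum (?A(i := {n})) - box_sum (?A(i := {0}))) / real (\<Prod>i=1..k. n)"
    unfolding M_def positive_linear_map_linear(4)[OF positive[OF \<open>i \<in> {1..k}\<close>]]
      scaleR_diff_right[symmetric] diff by simp
  also have "\<dots> \<le> (real (\<Prod>i=1..k. n) / real n * D + real (\<Prod>i=1..k. n) / real n * D) / real (\<Prod>i=1..k. n)"
    by (intro divide_right_mono order_trans[OF norm_triangle_ineq4] add_mono face) simp
  also have "\<dots> = 2 * D / real n"
    using \<open>0 < n\<close> by simp
  finally show ?thesis .
qed

lemma mean_bounded_imp_fixed_point:
  assumes "0 < c" "c \<le> d"
    and lower: "\<And>p. (\<And>i. i \<in> {1..k} \<Longrightarrow> 1 \<le> p i) \<Longrightarrow>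
      c *\<^sub>R 1 \<le> (1 / real (\<Prod>i=1..k. p i)) *\<^sub>R box_sum (\<lambda>i. {..<p i})"
    and upper: "\<And>p. (\<And>i. i \<in> {1..k} \<Longrightarrow> 1 \<le> p i) \<Longrightarrow>
      (1 / real (\<Prod>i=1..k. p i)) *\<^sub>R box_sum (\<lambda>i. {..<p i}) \<le> d *\<^sub>R 1"
  obtains Q where "0 \<le> Q" "bop_invertible Q" "\<And>i. i \<in> {1..k} \<Longrightarrow> \<Phi> i Q = Q"
proof -
  \<comment> \<open>Side \<open>Suc n\<close> keeps the cube nonempty at
    \<open>n = 0\<close>.\<close>
  define M where "M n = (1 / real (\<Prod>i=1..k. Suc n)) *\<^sub>R box_sum (\<lambda>_. {..<Suc n})" for n
  define D where "D = 2 ^ k * d / c"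
  have D: "0 < D"
    using assms(1,2) by (simp add: D_def)
  have orbit_le: "orbit s 1 \<le> D *\<^sub>R 1" for s
    unfolding D_def by (rule mean_bounded_imp_power_bounded[OF \<open>0 < c\<close> lower upper])
  have cM: "c *\<^sub>R 1 \<le> M n" for n
    unfolding M_def by (rule lower) simp
  have c0: "0 \<le> c *\<^sub>R (1 :: 'h bop)"
    using bop_scaleR_one_mono[of 0 c] \<open>0 < c\<close> by simp
  have norm_M: "norm (M n) \<le> d" for n
  proof (rule positive_norm_le)
    show "0 \<le> M n"
      by (rule order_trans[OF c0 cM])
    show "M n \<le> d *\<^sub>R 1"
      unfolding M_def by (rule upper) simp
  qed (use assms in simp)
  obtain Q F where F: "F \<le> sequentially" "F \<noteq> bot"
    and lim: "\<And>x y. ((\<lambda>n. cinner (M n \<cdot> x) y) \<longlongrightarrow> cinner (Q \<cdot> x) y) F"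
    by (rule bounded_sequence_weak_cluster_point[of M d, OF norm_M]) (rule that)
  have cQ: "c *\<^sub>R 1 \<le> Q"
    by (rule weak_limit_lower_bound[OF F(2) cM lim])
  have "\<Phi> i Q = Q" if i: "i \<in> {1..k}" for i
  \<comment> \<open>Along \<open>F\<close> the coefficients of \<open>\<Phi> i (M n)\<close> have
    two limits: those of \<open>\<Phi> i Q\<close> by weak-star continuity, and those of
    \<open>Q\<close> because \<open>\<Phi> i (M n) - M n\<close> tends to 0 in norm.\<close>
  proof (intro bop_eqI cinner_eqI)
    fix x y
    have "limitin weak_star (\<Phi> i \<circ> M) (\<Phi> i Q) F"
      by (rule continuous_map_limit[OF weak_star_continuous[OF i]
            limitin_weak_starI[OF F(2) norm_M lim]])
    then have "((\<lambda>n. cinner (\<Phi> i (M n) \<cdot> x) y) \<longlongrightarrow> cinner (\<Phi> i Q \<cdot> x) y) F"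
      using limitin_weak_star_cinner[where X = "\<Phi> i \<circ> M"] by simp
    moreover have "((\<lambda>n. cinner (\<Phi> i (M n) \<cdot> x) y) \<longlongrightarrow> cinner (Q \<cdot> x) y) F"
    proof -
      have "(\<lambda>n. \<Phi> i (M n) - M n) \<longlonglongrightarrow> 0"
      proof (rule Lim_null_comparison)
        show "\<forall>\<^sub>F n in sequentially. norm (\<Phi> i (M n) - M n) \<le> 2 * D * inverse (real (Suc n))"
          unfolding M_def divide_inverse[symmetric]
          by (intro always_eventually allI norm_\<Phi>_mean_diff_le orbit_le D i) simp
        show "(\<lambda>n. 2 * D * inverse (real (Suc n))) \<longlonglongrightarrow> 0"
          by (intro tendsto_mult_right_zero LIMSEQ_inverse_real_of_nat)
      qed
      then have "((\<lambda>n. \<Phi> i (M n) - M n) \<longlongrightarrow> 0) F"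
        by (rule tendsto_mono[OF F(1)])
      then have "((\<lambda>n. cinner ((\<Phi> i (M n) - M n) \<cdot> x) y) \<longlongrightarrow> cinner (0 \<cdot> x) y) F"
        by (intro cinner.tendsto bop_apply.tendsto tendsto_const)
      from tendsto_add[OF this lim[of x y]] show ?thesis
        by (simp add: cinner.diff_left)
    qed
    ultimately show "cinner (\<Phi> i Q \<cdot> x) y = cinner (Q \<cdot> x) y"
      by (rule tendsto_unique[OF F(2)])
  qed
  then show thesis
    by (rule that[OF order_trans[OF c0 cQ] bounded_below_bop_invertible[OF cQ \<open>0 < c\<close>]])
qed

text \<open>Applying \<open>orbit s\<close> to
  \<open>a *\<^sub>R 1 \<le> Q \<le> b *\<^sub>R 1\<close> leaves \<open>Q\<close> in place and
  replaces the identity by \<open>orbit s 1\<close>; comparison with the original inequalities gives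
  the constants a/b and b/a.\<close>

lemma fixed_point_imp_power_bounded:
  assumes "0 \<le> Q" "bop_invertible Q" and fixed: "\<forall>i\<in>{1..k}. \<Phi> i Q = Q"
  shows "\<exists>c d. 0 < c \<and> c \<le> d \<and> (\<forall>s. c *\<^sub>R 1 \<le> orbit s 1 \<and> orbit s 1 \<le> d *\<^sub>R 1)"
proof -
  obtain a b where ab: "0 < a" "a < b" "a *\<^sub>R 1 \<le> Q" "Q \<le> b *\<^sub>R 1"
    using positive_invertible_bounds[OF assms(1,2)] .
  note linear = positive_linear_map_linear(4)[OF positive_orbit]
    and mono = positive_linear_map_mono[OF positive_orbit]
  have fixed: "orbit s Q = Q" for s
    by (rule orbit_fixed_point) (rule bspec[OF fixed])
  have "(a / b) *\<^sub>R 1 \<le> orbit s 1" for s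
  proof -
    have "a *\<^sub>R 1 \<le> b *\<^sub>R orbit s 1"
      using order_trans[OF ab(3) mono[OF ab(4), of s, unfolded linear fixed]] by simp
    from bop_scaleR_mono[OF this, of "1 / b"] show ?thesis
      using ab by simp
  qed
  moreover have "orbit s 1 \<le> (b / a) *\<^sub>R 1" for s
  proof -
    have "a *\<^sub>R orbit s 1 \<le> b *\<^sub>R 1"
      using order_trans[OF mono[OF ab(3), of s, unfolded linear fixed] ab(4)] by simp
    from bop_scaleR_mono[OF this, of "1 / a"] show ?thesis
      using ab by simp
  qed
  moreover have "a / b \<le> b / a"
    using ab by (simp add: field_simps mult_mono)
  moreover have "0 < a / b"
    using ab by simp
  ultimately show ?thesis
    by blast
qed

end


section \<open>Joint similarity\<close>

lemma conjugation_nonneg: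
  assumes "0 \<le> X"
  shows "0 \<le> A * X * bop_adjoint A"
proof -
  have "cinner ((A * X * bop_adjoint A) \<cdot> x) x = cinner (X \<cdot> (bop_adjoint A \<cdot> x)) (bop_adjoint A \<cdot> x)" for x
    by (simp add: cinner_bop_adjoint)
  with assms show ?thesis
    by (simp add: less_eq_bop_def bop_positive_def del: bop_apply_simps)
qed

lemma bop_invertible_mult_adjoint:
  assumes "bop_invertible R"
  shows "bop_invertible (R * bop_adjoint R)"
proof -
  obtain S where S: "R * S = 1" "S * R = 1"
    using assms by (auto simp: bop_invertible_def)
  have adjoint_mult: "bop_adjoint (A * B) = bop_adjoint B * bop_adjoint A" for A B :: "'a bop"
    by (rule bop_adjoint_eqI) (simp add: cinner_bop_adjoint)
  have adjoint_one: "bop_adjoint (1 :: 'a bop) = 1"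
    by (rule bop_adjoint_eqI) simp
  have "bop_adjoint R * bop_adjoint S = 1" "bop_adjoint S * bop_adjoint R = 1"
    using S by (simp_all add: adjoint_one flip: adjoint_mult)
  then have "R * (bop_adjoint R * bop_adjoint S) * S = 1" "bop_adjoint S * (S * R) * bop_adjoint R = 1"
    using S by simp_all
  then show ?thesis
    unfolding bop_invertible_def by (intro exI[of _ "bop_adjoint S * S"]) (simp add: mult.assoc)
qed

text \<open>With \<open>R\<close> chosen, the similarity equation leaves only
  \<open>\<Lambda> i X = S * \<Phi> i (R * X * R) * S\<close> for the inverse \<open>S\<close> of
  \<open>R\<close>. The identity is fixed because \<open>R * R = Q\<close> is.\<close>

lemma fixed_point_imp_jointly_similar:
  fixes Q :: "'h::complex_hilbert_space bop"
  assumes tuple: "commuting_positive_tuple k \<Phi>" and Q: "0 \<le> Q" "bop_invertible Q"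
    and fixed: "\<forall>i\<in>{1..k}. \<Phi> i Q = Q"
  shows "\<exists>\<Lambda>. commuting_positive_tuple k \<Lambda> \<and> (\<forall>i\<in>{1..k}. \<Lambda> i 1 = 1) \<and> jointly_similar k \<Phi> \<Lambda>"
proof -
  interpret commuting_positive k \<Phi>
    by standard (rule tuple)
  obtain R where R: "R * R = Q" "bop_adjoint R = R" "bop_invertible R"
    using self_adjoint_square_root[OF Q] .
  obtain S where S: "R * S = 1" "S * R = 1"
    using R(3) by (auto simp: bop_invertible_def)
  have cancel: "R * (S * X) = X" "S * (R * X) = X" for X
    by (simp_all add: S flip: mult.assoc)
  \<comment> \<open>Self-adjointness of \<open>S\<close> follows by moving \<open>R\<close> across
    in \<open>R * S = 1\<close>; it puts conjugation by \<open>S\<close> into the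
    positivity-preserving form of \<open>conjugation_nonneg\<close>.\<close>
  have "cinner (S \<cdot> x) y = cinner x (S \<cdot> y)" for x y
  proof -
    have "cinner (S \<cdot> x) ((R * S) \<cdot> y) = cinner ((R * S) \<cdot> x) (S \<cdot> y)"
      by (simp add: cinner_bop_adjoint R(2))
    then show ?thesis
      by (simp add: S del: bop_apply_simps(8))
  qed
  then have S_adj: "bop_adjoint S = S"
    by (rule bop_adjoint_eqI)
  define \<Lambda> where "\<Lambda> i X = S * \<Phi> i (R * X * R) * S" for i X
  have "positive_linear_map (\<Lambda> i)" if "i \<in> {1..k}" for i
  proof (rule positive_linear_mapI)
    note linear = positive_linear_map_linear[OF positive[OF that]]
    have scaleC_mult: "(c *\<^sub>C A) * B = c *\<^sub>C (A * B)" "A * (c *\<^sub>C B) = c *\<^sub>C (A * B)"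
      for c and A B :: "'h bop"
      by (rule bop_eqI; simp)+
    show "\<Lambda> i (X + Y) = \<Lambda> i X + \<Lambda> i Y" for X Y
      by (simp add: \<Lambda>_def linear distrib_left distrib_right)
    show "\<Lambda> i (c *\<^sub>C X) = c *\<^sub>C \<Lambda> i X" for c X
      by (simp add: \<Lambda>_def linear scaleC_mult)
    show "0 \<le> \<Lambda> i X" if X: "0 \<le> X" for X
      unfolding \<Lambda>_def
      using conjugation_nonneg[OF positive_linear_map_nonneg[OF positive[OF \<open>i \<in> {1..k}\<close>]
            conjugation_nonneg[OF X, of R]], of S]
      by (simp add: R(2) S_adj)
  qed
  moreover have "continuous_map weak_star weak_star (\<Lambda> i)" if "i \<in> {1..k}" for i
  proof -
    have "\<Lambda> i = (\<lambda>X. S * X * S) \<circ> (\<Phi> i \<circ> (\<lambda>X. R * X * R))"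
      by (simp add: \<Lambda>_def fun_eq_iff)
    then show ?thesis
      using continuous_map_compose[OF continuous_map_compose[OF
            continuous_map_weak_star_conjugation weak_star_continuous[OF that]]
          continuous_map_weak_star_conjugation] by simp
  qed
  \<comment> \<open>In the composite the inner factors \<open>R * S\<close> and \<open>S * R\<close>
    cancel, leaving the composite of \<open>\<Phi> i\<close> and \<open>\<Phi> j\<close> conjugated
    once.\<close>
  moreover have "\<Lambda> i \<circ> \<Lambda> j = \<Lambda> j \<circ> \<Lambda> i" if "i \<in> {1..k}" "j \<in> {1..k}" for i j
    using fun_cong[OF commute[OF that]] by (simp add: \<Lambda>_def fun_eq_iff mult.assoc cancel S)
  ultimately have "commuting_positive_tuple k \<Lambda>"
    by (simp add: commuting_positive_tuple_def)
  moreover have "\<Lambda> i 1 = 1" if "i \<in> {1..k}" for i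
  proof -
    have "\<Lambda> i 1 = S * Q * S"
      using fixed that by (simp add: \<Lambda>_def R(1))
    also have "\<dots> = 1"
      by (simp add: R(1)[symmetric] mult.assoc S cancel)
    finally show ?thesis .
  qed
  moreover have "jointly_similar k \<Phi> \<Lambda>"
    unfolding jointly_similar_def
    by (rule exI[of _ R]) (simp add: R(2,3) \<Lambda>_def mult.assoc cancel S)
  ultimately show ?thesis
    by blast
qed

text \<open>The fixed point is \<open>R * bop_adjoint R\<close>, the image of the identity under the
  similarity.\<close>

lemma jointly_similar_imp_fixed_point:
  assumes "jointly_similar k \<Phi> \<Lambda>" "\<forall>i\<in>{1..k}. \<Lambda> i 1 = 1"
  shows "\<exists>Q. 0 \<le> Q \<and> bop_invertible Q \<and> (\<forall>i\<in>{1..k}. \<Phi> i Q = Q)"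
proof -
  obtain R where R: "bop_invertible R"
    and sim: "\<And>X i. i \<in> {1..k} \<Longrightarrow> \<Phi> i (R * X * bop_adjoint R) = R * \<Lambda> i X * bop_adjoint R"
    using assms(1) by (auto simp: jointly_similar_def)
  have "\<Phi> i (R * bop_adjoint R) = R * bop_adjoint R" if "i \<in> {1..k}" for i
    using sim[OF that, of 1] assms(2) that by simp
  moreover have "0 \<le> R * bop_adjoint R"
    using conjugation_nonneg[of 1 R] bop_scaleR_one_mono[of 0 1] by simp
  ultimately show ?thesis
    using bop_invertible_mult_adjoint[OF R] by blast
qed

section \<open>The equivalence of the four conditions\<close>

lemma all_equivalentI:
  assumes "A \<Longrightarrow> D" "D \<Longrightarrow> A" "D \<Longrightarrow> B" "B \<Longrightarrow> C" "C \<Longrightarrow> D"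
  shows "all_equivalent [A, B, C, D]"
proof -
  have "A = D" "B = D" "C = D"
    using assms by blast+
  then show ?thesis
    by (simp add: all_equivalent_def)
qed

theorem theorem5p3:
  fixes \<Phi> :: "nat \<Rightarrow> 'h::complex_hilbert_space bop \<Rightarrow> 'h bop" and k :: nat
  assumes "separable_space (euclidean :: 'h topology)"
    and "1 \<le> k"
    and "commuting_positive_tuple k \<Phi>"
  shows "all_equivalent
    [\<exists>\<Lambda> :: nat \<Rightarrow> 'h bop \<Rightarrow> 'h bop.
       commuting_positive_tuple k \<Lambda> \<and> (\<forall>i\<in>{1..k}. \<Lambda> i 1 = 1) \<and> jointly_similar k \<Phi> \<Lambda>,
     \<exists>c d :: real. 0 < c \<and> c \<le> d \<and>
       (\<forall>s :: nat \<Rightarrow> nat.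
          c *\<^sub>R 1 \<le> comp_powers \<Phi> s [1..<k+1] 1 \<and>
          comp_powers \<Phi> s [1..<k+1] 1 \<le> d *\<^sub>R 1),
     \<exists>c d :: real. 0 < c \<and> c \<le> d \<and>
       (\<forall>p :: nat \<Rightarrow> nat. (\<forall>i\<in>{1..k}. 1 \<le> p i) \<longrightarrow>
          c *\<^sub>R 1 \<le> (1 / real (\<Prod>i=1..k. p i)) *\<^sub>R
            (\<Sum>s\<in>(\<Pi>\<^sub>E i\<in>{1..k}. {0..p i - 1}). comp_powers \<Phi> s (rev [1..<k+1]) 1) \<and>
          (1 / real (\<Prod>i=1..k. p i)) *\<^sub>R
            (\<Sum>s\<in>(\<Pi>\<^sub>E i\<in>{1..k}. {0..p i - 1}). comp_powers \<Phi> s (rev [1..<k+1]) 1) \<le> d *\<^sub>R 1),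
     \<exists>Q :: 'h bop. 0 \<le> Q \<and> bop_invertible Q \<and> (\<forall>i\<in>{1..k}. \<Phi> i Q = Q)]"
    (is "all_equivalent [?similar, ?power_bounded, ?mean_bounded, ?fixed_point]")
proof -
  interpret commuting_positive k \<Phi>
    by standard fact
  define mean where "mean p = (1 / real (\<Prod>i=1..k. p i)) *\<^sub>R
    (\<Sum>s\<in>(\<Pi>\<^sub>E i\<in>{1..k}. {0..p i - 1}). comp_powers \<Phi> s (rev [1..<k+1]) (1 :: 'h bop))" for p
  \<comment> \<open>The condition \<open>1 \<le> p i\<close> matters: with truncated subtraction
    \<open>{0..p i - 1}\<close> is \<open>{0}\<close>, not empty, at \<open>p i = 0\<close>.\<close>
  have mean_eq: "mean p = (1 / real (\<Prod>i=1..k. p i)) *\<^sub>R box_sum (\<lambda>i. {..<p i})"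
    if p: "\<forall>i\<in>{1..k}. 1 \<le> p i" for p
  proof -
    have "{0..p i - 1} = {..<p i}" if "i \<in> {1..k}" for i
      using bspec[OF p that] by auto
    then have "(\<Pi>\<^sub>E i\<in>{1..k}. {0..p i - 1}) = (\<Pi>\<^sub>E i\<in>{1..k}. {..<p i})"
      by (rule PiE_cong)
    then show ?thesis
      unfolding mean_def box_sum_def comp_powers_rev_eq_orbit by simp
  qed
  show ?thesis
  proof (rule all_equivalentI)
    assume ?similar
    then show ?fixed_point
      using jointly_similar_imp_fixed_point by blast
  next
    assume ?fixed_point
    then show ?similar
      using fixed_point_imp_jointly_similar[OF tuple] by blast
  next
    assume ?fixed_point
    then obtain Q where "0 \<le> Q" "bop_invertible Q" "\<forall>i\<in>{1..k}. \<Phi> i Q = Q"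
      by blast
    then show ?power_bounded
      unfolding orbit_def[symmetric] by (rule fixed_point_imp_power_bounded)
  next
    assume ?power_bounded
    then obtain c d where cd: "0 < c" "c \<le> d"
      and bounds: "\<And>s. c *\<^sub>R 1 \<le> orbit s 1" "\<And>s. orbit s 1 \<le> d *\<^sub>R 1"
      unfolding orbit_def by blast
    have "c *\<^sub>R 1 \<le> mean p \<and> mean p \<le> d *\<^sub>R 1" if p: "\<forall>i\<in>{1..k}. 1 \<le> p i" for p
    proof -
      define N where "N = real (\<Prod>i=1..k. p i)"
      have N: "0 < N"
        unfolding N_def of_nat_0_less_iff using p by (intro prod_pos) fastforce
      have "(N * c) *\<^sub>R 1 \<le> box_sum (\<lambda>i. {..<p i})" "box_sum (\<lambda>i. {..<p i}) \<le> (N * d) *\<^sub>R 1"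
        using box_sum_bounds(2)[OF bounds(1), of "\<lambda>i. {..<p i}"]
          box_sum_bounds(1)[OF bounds(2), of "\<lambda>i. {..<p i}"] by (simp_all add: N_def)
      from this[THEN bop_scaleR_mono, of "1 / N"] show ?thesis
        unfolding mean_eq[OF p] N_def[symmetric] using N by simp
    qed
    with cd have "\<exists>c d. 0 < c \<and> c \<le> d \<and>
        (\<forall>p. (\<forall>i\<in>{1..k}. 1 \<le> p i) \<longrightarrow> c *\<^sub>R 1 \<le> mean p \<and> mean p \<le> d *\<^sub>R 1)"
      by blast
    then show ?mean_bounded
      unfolding mean_def .
  next
    assume ?mean_bounded
    then have "\<exists>c d. 0 < c \<and> c \<le> d \<and>
        (\<forall>p. (\<forall>i\<in>{1..k}. 1 \<le> p i) \<longrightarrow> c *\<^sub>R 1 \<le> mean p \<and> mean p \<le> d *\<^sub>R 1)"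
      unfolding mean_def .
    then obtain c d where cd: "0 < c" "c \<le> d"
      and bounds: "\<And>p. \<forall>i\<in>{1..k}. 1 \<le> p i \<Longrightarrow> c *\<^sub>R 1 \<le> mean p"
        "\<And>p. \<forall>i\<in>{1..k}. 1 \<le> p i \<Longrightarrow> mean p \<le> d *\<^sub>R 1"
      by blast
    show ?fixed_point
    proof (rule mean_bounded_imp_fixed_point[OF cd])
      fix p :: "nat \<Rightarrow> nat" assume "\<And>i. i \<in> {1..k} \<Longrightarrow> 1 \<le> p i"
      then have p: "\<forall>i\<in>{1..k}. 1 \<le> p i"
        by blast
      show "c *\<^sub>R 1 \<le> (1 / real (\<Prod>i=1..k. p i)) *\<^sub>R box_sum (\<lambda>i. {..<p i})"
        "(1 / real (\<Prod>i=1..k. p i)) *\<^sub>R box_sum (\<lambda>i. {..<p i}) \<le> d *\<^sub>R 1"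
        unfolding mean_eq[OF p, symmetric] by (rule bounds[OF p])+
    qed blast
  qed
qed

end
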